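(* Let $F(z)=\sum_{s=1}^{\mu}\frac{v_s}{z-z_s}+u(z)$ be a vector-valued rational function, where $u$ is a polynomial with values in $\mathbb{C}^N$, $z_1,\dots,z_\mu$ are distinct complex numbers, and $v_1,\dots,v_\mu\in\mathbb{C}^N$ are nonzero. Assume that $F$ is analytic in $E$ (so that $z_1,\dots,z_\mu\in K$), with poles ordered so that $\Phi(z_1)\le\Phi(z_2)\le\cdots\le\Phi(z_\mu)$. Let $1\le k<\mu$ be fixed and assume $$\Phi(z_k)<\Phi(z_{k+1})=\cdots=\Phi(z_{k+r})<\Phi(z_{k+r+1}),$$ where $\Phi(z_{k+r+1})$ is defined to be $\infty$ in case $k+r=\mu$. Assume also that $\prod_{i=1}^k(q,v_i)\neq0$. Then $T_{1,\dots,k}\neq0$, and $$Q(z)=(-1)^kT_{1,\dots,k}\,V(z,z_1,\dots,z_k)\Big[\prod_{i=1}^k\Psi_p(z_i)\Big]^{-1}\Big[1+O\Big(\frac{\Psi_p(z_k)}{\widetilde\Psi_{p,k}}\Big)\Big]\quad\text{as }p\to\infty,$$ uniformly in every compact subset of $\mathbb{C}\setminus\{z_1,\dots,z_k\}$, where $$|\widetilde\Psi_{p,k}|=\min_{1\le j\le r}|\Psi_p(z_{k+j})|.$$ Thus, with the normalization $c_k=1$ and with $S(z)=\prod_{i=1}^k(z-z_i)$, $$V_{p,k}(z)-S(z)=O\Big(\frac{\Psi_p(z_k)}{\widetilde\Psi_{p,k}}\Big)\quad\text{as }p\to\infty,$$ and consequently $$\limsup_{p\to\infty}|V_{p,k}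(z)-S(z)|^{1/p}\le\frac{\Phi(z_k)}{\Phi(z_{k+1})}.$$
   Context: Sets and interpolation points. $E$ is a closed and bounded set in the complex plane whose complement $K$ (which includes the point at infinity) has a classical Green's function $g(z)$ with pole at infinity, continuous on $\partial E$ and zero on $\partial E$. Put $\Phi(z)=\exp[g(z)]$ and $\kappa=\mathrm{cap}(E)$, the logarithmic capacity of $E$. For each $p\in\{1,2,\dots\}$ there is given a set of interpolation points $\xi^{(p)}_1,\dots,\xi^{(p)}_{p+k}$, not necessarily distinct (equal points being listed consecutively), such that the $\xi_i^{(p)}$ have no limit points in $K$ and $$\lim_{p\to\infty}\Big|\prod_{i=1}^{p+k}(z-\xi_i^{(p)})\Big|^{1/p}=\kappa\,\Phi(z)$$ uniformly in $z$ on every compact subset of $K$. For fixed $p$ write $\xi_i=\xi_i^{(p)}$. The ITEA construction. $(\cdot,\cdot)$ is an inner product on $\mathbb{C}^N$ (linear in its second argument) and $q\in\mathbb{C}^N$ is a fixed nonzero vector. Put $\psi_{m,n}(z)=\prod_{r=m}^n(z-\xi_r)$ for $n\ge m\ge1$, $\psi_{m,m-1}(z)=1$, and $\Psi_p(z)=\psi_{1,p+k}(z)$. Let $D_{m,n}=F[\xi_m,\dots,\xi_n]$ be the divided difference of $F$ over $\{\xi_m,\dots,\xi_n\}$ (in the generalized Hermite sense if points coincide), and put $u_{i,j}=(q,D_{j+1,p+i})$. The denominator polynomial is $V_{p,k}(z)=\sum_{j=0}^kc_j\psi_{1,j}(z)$, where $c_k=1$ and $c_0,\dots,c_{k-1}$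 solve $\sum_{j=0}^{k-1}u_{i,j}c_j=-u_{i,k}$, $i=1,\dots,k$ (uniquely solvable when $\det(u_{i,j})_{1\le i\le k,\,0\le j\le k-1}\ne0$). $Q(z)$ (depending on $p$) is the $(k+1)\times(k+1)$ determinant with first row $\psi_{1,0}(z),\psi_{1,1}(z),\dots,\psi_{1,k}(z)$ and with $(i+1)$-st row $u_{i,0},u_{i,1},\dots,u_{i,k}$ for $i=1,\dots,k$. Determinants. $V(x_0,x_1,\dots,x_n)=\prod_{0\le i<j\le n}(x_j-x_i)$ is the Vandermonde determinant. $T_{s_1,\dots,s_k}=\det(\alpha_{i,s_j})_{1\le i,j\le k}$, where $\alpha_{i,s}=(q,v_s)\,\psi_{p+i+1,p+k}(z_s)$; this determinant does not depend on $p$.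
   Formalization: In the error terms, |Ψ_p(z_k)| is replaced by the maximum of |Ψ_p(z_i)| over i ≤ k with Φ(z_i) = Φ(z_k); with Ψ_p(z_k) alone the O-estimates can fail when several of z_1,…,z_k share the level of z_k. Without such ties the two agree. *)

theory Defs
  imports
    "HOL-Complex_Analysis.Complex_Analysis"
    "Jordan_Normal_Form.Determinant"
begin

(* Both imports introduce the infix $ for vector components; keep the one of HOL-Analysis. *)
no_notation Matrix.vec_index (infixl \<open>$\<close> 100)

text \<open>Twice continuously differentiable with vanishing Laplacian; \<open>gx\<close>, \<open>gy\<close>, \<open>gxx\<close>, \<open>gxy\<close>, \<open>gyy\<close>
  are the partial derivatives with respect to \<open>x = Re z\<close> and \<open>y = Im z\<close>.\<close>

definition harmonic_on :: "(complex \<Rightarrow> real) \<Rightarrow> complex set \<Rightarrow> bool" where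
  "harmonic_on g S \<longleftrightarrow> open S \<and>
     (\<exists>gx gy gxx gxy gyy.
        continuous_on S gxx \<and> continuous_on S gxy \<and> continuous_on S gyy \<and>
        (\<forall>z\<in>S.
           (g has_derivative (\<lambda>h. gx z * Re h + gy z * Im h)) (at z) \<and>
           (gx has_derivative (\<lambda>h. gxx z * Re h + gxy z * Im h)) (at z) \<and>
           (gy has_derivative (\<lambda>h. gxy z * Re h + gyy z * Im h)) (at z) \<and>
           gxx z + gyy z = 0))"

text \<open>Classical Green's function, with pole at infinity, of the complement of the compact set \<open>E\<close> in
  the Riemann sphere. Only its values on \<open>closure (- E) = - E \<union> frontier E\<close> matter.\<close>

definition greens_function :: "complex set \<Rightarrow> (complex \<Rightarrow> real) \<Rightarrow> bool" where
  "greens_function E g \<longleftrightarrow>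
     harmonic_on g (- E) \<and>
     continuous_on (closure (- E)) g \<and>
     (\<forall>z\<in>frontier E. g z = 0) \<and>
     (\<exists>\<gamma>. ((\<lambda>z. g z - ln (norm z)) \<longlongrightarrow> \<gamma>) at_infinity)"

text \<open>Logarithmic capacity, in the form of the Chebyshev constant: the limit of the \<open>n\<close>-th roots of the
  least maximum modulus on \<open>E\<close> of a monic polynomial of degree \<open>n\<close>.\<close>

definition log_capacity :: "complex set \<Rightarrow> real" where
  "log_capacity E =
     lim (\<lambda>n. root n (INF r\<in>{r :: complex poly. degree r = n \<and> lead_coeff r = 1}.
                          SUP z\<in>E. norm (poly r z)))"

text \<open>Row \<open>p\<close> of the array consists of \<open>\<xi> p 1, \<dots>, \<xi> p (p + k)\<close>. Since rows are finite, infinitely many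
  entries of the array lie in a set iff this is so for infinitely many rows.\<close>

definition array_limit_point :: "nat \<Rightarrow> (nat \<Rightarrow> nat \<Rightarrow> complex) \<Rightarrow> complex \<Rightarrow> bool" where
  "array_limit_point k \<xi> z \<longleftrightarrow>
     (\<forall>U. open U \<and> z \<in> U \<longrightarrow> (\<exists>\<^sub>F p in sequentially. \<exists>i\<in>{1..p + k}. \<xi> p i \<in> U))"

definition array_limit_point_infinity :: "nat \<Rightarrow> (nat \<Rightarrow> nat \<Rightarrow> complex) \<Rightarrow> bool" where
  "array_limit_point_infinity k \<xi> \<longleftrightarrow>
     (\<forall>R. \<exists>\<^sub>F p in sequentially. \<exists>i\<in>{1..p + k}. norm (\<xi> p i) > R)"

definition equal_points_consecutive :: "(nat \<Rightarrow> complex) \<Rightarrow> nat \<Rightarrow> bool" where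
  "equal_points_consecutive x n \<longleftrightarrow>
     (\<forall>i j l. 1 \<le> i \<and> i \<le> j \<and> j \<le> l \<and> l \<le> n \<and> x i = x l \<longrightarrow> x j = x i)"

text \<open>Linear in the second argument; that \<open>ip x x\<close> is real follows from Hermitian symmetry.\<close>

definition inner_product :: "(complex ^ 'n \<Rightarrow> complex ^ 'n \<Rightarrow> complex) \<Rightarrow> bool" where
  "inner_product ip \<longleftrightarrow>
     (\<forall>x y z. ip x (y + z) = ip x y + ip x z) \<and>
     (\<forall>x c y. ip x (c *s y) = c * ip x y) \<and>
     (\<forall>x y. ip x y = cnj (ip y x)) \<and>
     (\<forall>x. x \<noteq> 0 \<longrightarrow> Re (ip x x) > 0)"

text \<open>\<open>divdiff f x m d\<close> is the generalized divided difference of \<open>f\<close> over \<open>x m, \<dots>, x (m + d)\<close>. As equal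
  points are consecutive, \<open>x m = x (m + d)\<close> means that all \<open>d + 1\<close> points coincide.\<close>

fun divdiff :: "(complex \<Rightarrow> complex) \<Rightarrow> (nat \<Rightarrow> complex) \<Rightarrow> nat \<Rightarrow> nat \<Rightarrow> complex" where
  "divdiff f x m 0 = f (x m)"
| "divdiff f x m (Suc d) =
     (if x m = x (m + Suc d) then (deriv ^^ Suc d) f (x m) / fact (Suc d)
      else (divdiff f x (Suc m) d - divdiff f x m d) / (x (m + Suc d) - x m))"

text \<open>\<open>D\<^bsub>m,n\<^esub>\<close>, meaningful for \<open>m \<le> n\<close>.\<close>

definition vec_divdiff ::
    "(complex \<Rightarrow> complex ^ 'n) \<Rightarrow> (nat \<Rightarrow> complex) \<Rightarrow> nat \<Rightarrow> nat \<Rightarrow> complex ^ 'n" where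
  "vec_divdiff F x m n = (\<chi> l. divdiff (\<lambda>z. F z $ l) x m (n - m))"

text \<open>From here on \<open>x\<close> is the row \<open>\<xi> p\<close> of interpolation points.\<close>

definition psi :: "(nat \<Rightarrow> complex) \<Rightarrow> nat \<Rightarrow> nat \<Rightarrow> complex \<Rightarrow> complex" where
  "psi x m n z = (\<Prod>r=m..n. z - x r)"

text \<open>The divided difference \<open>D\<^bsub>j+1,p+i\<^esub>\<close> is meaningful for all \<open>1 \<le> i \<le> k\<close>, \<open>0 \<le> j \<le> k\<close> once \<open>p \<ge> k\<close>.\<close>

definition itea_u ::
    "(complex ^ 'n \<Rightarrow> complex ^ 'n \<Rightarrow> complex) \<Rightarrow> complex ^ 'n \<Rightarrow> (complex \<Rightarrow> complex ^ 'n) \<Rightarrow>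
      (nat \<Rightarrow> complex) \<Rightarrow> nat \<Rightarrow> nat \<Rightarrow> nat \<Rightarrow> complex" where
  "itea_u ip q F x p i j = ip q (vec_divdiff F x (j + 1) (p + i))"

definition itea_system :: "(nat \<Rightarrow> nat \<Rightarrow> complex) \<Rightarrow> nat \<Rightarrow> complex mat" where
  "itea_system u k = Matrix.mat k k (\<lambda>(i, j). u (i + 1) j)"

text \<open>Coefficients \<open>c\<^sub>0, \<dots>, c\<^sub>k\<close> of the denominator for a given array \<open>u\<close>, extended by \<open>0\<close>; meaningful iff
  \<open>det (itea_system u k) \<noteq> 0\<close>.\<close>

definition itea_coeffs :: "(nat \<Rightarrow> nat \<Rightarrow> complex) \<Rightarrow> nat \<Rightarrow> nat \<Rightarrow> complex" where
  "itea_coeffs u k =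
     (THE c. (\<forall>j>k. c j = 0) \<and> c k = 1 \<and> (\<forall>i\<in>{1..k}. (\<Sum>j<k. u i j * c j) = - u i k))"

definition itea_denom ::
    "(nat \<Rightarrow> nat \<Rightarrow> complex) \<Rightarrow> (nat \<Rightarrow> complex) \<Rightarrow> nat \<Rightarrow> complex \<Rightarrow> complex" where
  "itea_denom u x k z = (\<Sum>j\<le>k. itea_coeffs u k j * psi x 1 j z)"

definition itea_Q ::
    "(nat \<Rightarrow> nat \<Rightarrow> complex) \<Rightarrow> (nat \<Rightarrow> complex) \<Rightarrow> nat \<Rightarrow> complex \<Rightarrow> complex" where
  "itea_Q u x k z =
     Determinant.det (Matrix.mat (k + 1) (k + 1) (\<lambda>(i, j). if i = 0 then psi x 1 j z else u i j))"

definition vandermonde :: "nat \<Rightarrow> (nat \<Rightarrow> complex) \<Rightarrow> complex" where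
  "vandermonde n x = (\<Prod>j\<le>n. \<Prod>i<j. x j - x i)"

definition alpha ::
    "(complex ^ 'n \<Rightarrow> complex ^ 'n \<Rightarrow> complex) \<Rightarrow> complex ^ 'n \<Rightarrow> (nat \<Rightarrow> complex ^ 'n) \<Rightarrow>
      (nat \<Rightarrow> complex) \<Rightarrow> (nat \<Rightarrow> complex) \<Rightarrow> nat \<Rightarrow> nat \<Rightarrow> nat \<Rightarrow> nat \<Rightarrow> complex" where
  "alpha ip q v zs x p k i s = ip q (v s) * psi x (p + i + 1) (p + k) (zs s)"

text \<open>\<open>T\<close> for the index tuple \<open>\<sigma> 1, \<dots>, \<sigma> k\<close>. It is written with \<open>p\<close> and the row \<open>x = \<xi> p\<close>, although its value
  does not depend on them.\<close>

definition T_det ::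
    "(complex ^ 'n \<Rightarrow> complex ^ 'n \<Rightarrow> complex) \<Rightarrow> complex ^ 'n \<Rightarrow> (nat \<Rightarrow> complex ^ 'n) \<Rightarrow>
      (nat \<Rightarrow> complex) \<Rightarrow> (nat \<Rightarrow> complex) \<Rightarrow> nat \<Rightarrow> nat \<Rightarrow> (nat \<Rightarrow> nat) \<Rightarrow> complex" where
  "T_det ip q v zs x p k \<sigma> =
     Determinant.det (Matrix.mat k k (\<lambda>(i, j). alpha ip q v zs x p k (i + 1) (\<sigma> (j + 1))))"

text \<open>\<open>Psi_tilde\<close> is the minimum of \<open>\<bar>\<Psi>\<^sub>p\<bar>\<close> over the poles \<open>z\<^bsub>k+1\<^esub>, \<dots>, z\<^bsub>k+r\<^esub>\<close>, which share one level of \<open>\<Phi>\<close>.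
  Dually, \<open>Psi_hat\<close> is the maximum of \<open>\<bar>\<Psi>\<^sub>p\<bar>\<close> over those of the poles \<open>z\<^sub>1, \<dots>, z\<^sub>k\<close> that lie on the same level
  as \<open>z\<^sub>k\<close>. It is \<open>\<bar>\<Psi>\<^sub>p(z\<^sub>k)\<bar>\<close> itself if \<open>k = 1\<close> or \<open>\<Phi>(z\<^bsub>k-1\<^esub>) < \<Phi>(z\<^sub>k)\<close>. On a shared level the quotients
  \<open>\<bar>\<Psi>\<^sub>p(z\<^sub>i) / \<Psi>\<^sub>p(z\<^sub>k)\<bar>\<close> need not be bounded in \<open>p\<close> (they may grow subexponentially), and then
  \<open>\<bar>\<Psi>\<^sub>p(z\<^sub>k)\<bar>\<close> alone does not control the error.\<close>

definition Psi_tilde ::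
    "(complex \<Rightarrow> complex) \<Rightarrow> (nat \<Rightarrow> complex) \<Rightarrow> nat \<Rightarrow> nat \<Rightarrow> real" where
  "Psi_tilde \<Psi> zs k r = Min ((\<lambda>j. norm (\<Psi> (zs (k + j)))) ` {1..r})"

definition Psi_hat ::
    "(complex \<Rightarrow> complex) \<Rightarrow> (complex \<Rightarrow> real) \<Rightarrow> (nat \<Rightarrow> complex) \<Rightarrow> nat \<Rightarrow> real" where
  "Psi_hat \<Psi> \<Phi> zs k = Max ((\<lambda>i. norm (\<Psi> (zs i))) ` {i \<in> {1..k}. \<Phi> (zs i) = \<Phi> (zs k)})"

end

theory Submission
  imports Defs
begin

text \<open>Since the divided differences of \<open>1 / (z - z\<^sub>s)\<close> are \<open>- 1 / \<psi>\<^bsub>m,n\<^esub>(z\<^sub>s)\<close>, and those of the polynomial part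
  vanish for large \<open>p\<close>, the entries become
  \<open>u\<^bsub>i,j\<^esub> = - (\<Sum>s. \<alpha>\<^bsub>i,s\<^esub> \<psi>\<^bsub>1,j\<^esub>(z\<^sub>s) / \<Psi>\<^sub>p(z\<^sub>s))\<close>. Column operations turn \<open>Q(z)\<close> into the \<open>k \<times> k\<close> determinant
  with entries \<open>- (\<Sum>s. \<alpha>\<^bsub>i,s\<^esub> (z\<^sub>s - z) \<psi>\<^bsub>1,j\<^esub>(z\<^sub>s) / \<Psi>\<^sub>p(z\<^sub>s))\<close>, and the determinant of the linear system has
  the same shape without the factors \<open>z\<^sub>s - z\<close>. By multilinearity both are sums over choices of \<open>k\<close> poles, with
  Vandermonde factors that kill repeated poles. The choices from \<open>z\<^sub>1, \<dots>, z\<^sub>k\<close> give the main term; in any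
  other one some \<open>\<Psi>\<^sub>p(z\<^sub>i)\<close> with \<open>i \<le> k\<close> is traded for some \<open>\<Psi>\<^sub>p(z\<^sub>s)\<close> with \<open>s > k\<close>, which costs at least a
  factor \<open>\<delta> p\<close>. The denominator polynomial is \<open>(-1)\<^sup>k\<close> times the quotient of the two determinants.\<close>

subsection \<open>Determinants in Newton form\<close>

lemma prod_list_diag_mat_eq_1:
  assumes "\<And>i. i < dim_row B \<Longrightarrow> B $$ (i, i) = (1 :: complex)"
  shows "prod_list (diag_mat B) = 1"
proof -
  have "diag_mat B = replicate (dim_row B) 1"
    using assms by (intro nth_equalityI) (auto simp: diag_mat_def)
  then show ?thesis by simp
qed

lemma det_row_factor:
  fixes r :: "nat \<Rightarrow> complex"
  shows "Determinant.det (Matrix.mat n n (\<lambda>(i, j). r i * A i j))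
    = (\<Prod>i<n. r i) * Determinant.det (Matrix.mat n n (\<lambda>(i, j). A i j))"
proof -
  have "(\<Prod>i = 0..<n. Matrix.mat n n (\<lambda>(i, j). r i * A i j) $$ (i, \<pi> i))
      = (\<Prod>i<n. r i) * (\<Prod>i = 0..<n. Matrix.mat n n (\<lambda>(i, j). A i j) $$ (i, \<pi> i))"
    if "\<pi> permutes {0..<n}" for \<pi>
  proof -
    have "\<pi> i < n" if "i < n" for i
      using permutes_in_image[OF \<open>\<pi> permutes {0..<n}\<close>, of i] that by auto
    then show ?thesis by (simp add: prod.distrib[symmetric] atLeast0LessThan)
  qed
  then show ?thesis
    by (auto simp: det_def'[of _ n] sum_distrib_left intro!: sum.cong)
qed

lemma det_col_factor:
  fixes r :: "nat \<Rightarrow> complex"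
  shows "Determinant.det (Matrix.mat n n (\<lambda>(i, j). A i j * r j))
    = Determinant.det (Matrix.mat n n (\<lambda>(i, j). A i j)) * (\<Prod>i<n. r i)"
proof -
  have "Determinant.det (Matrix.mat n n (\<lambda>(i, j). A i j * r j))
     = Determinant.det (Matrix.mat n n (\<lambda>(i, j). r i * A j i))"
    by (subst det_transpose[of _ n, symmetric]) (auto intro!: arg_cong[where f = Determinant.det])
  also have "\<dots> = (\<Prod>i<n. r i) * Determinant.det (Matrix.mat n n (\<lambda>(i, j). A j i))"
    by (rule det_row_factor)
  also have "Determinant.det (Matrix.mat n n (\<lambda>(i, j). A j i)) = Determinant.det (Matrix.mat n n (\<lambda>(i, j). A i j))"
    by (subst det_transpose[of _ n, symmetric]) (auto intro!: arg_cong[where f = Determinant.det])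
  finally show ?thesis by simp
qed

lemma psi_0: "psi x 1 0 z = 1"
  by (simp add: psi_def)

lemma psi_Suc: "psi x 1 (Suc j) z = psi x 1 j z * (z - x (Suc j))"
  by (simp add: psi_def)

text \<open>Column \<open>j - 1\<close> is subtracted \<open>z - x j\<close> times from column \<open>j\<close>; this clears the first row.\<close>

lemma det_first_row_psi:
  "Determinant.det (Matrix.mat (Suc n) (Suc n) (\<lambda>(i, j). if i = 0 then psi x 1 j z else A i j))
   = Determinant.det (Matrix.mat n n (\<lambda>(i, j). A (Suc i) (Suc j) - (z - x (Suc j)) * A (Suc i) j))"
proof -
  define M where "M = Matrix.mat (Suc n) (Suc n) (\<lambda>(i, j). if i = 0 then psi x 1 j z else A i j)"
  define B where "B = Matrix.mat (Suc n) (Suc n)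
    (\<lambda>(i, j). if i = j then 1 else if j = Suc i then - (z - x j) else 0)"
  have M [simp]: "M \<in> carrier_mat (Suc n) (Suc n)" and B [simp]: "B \<in> carrier_mat (Suc n) (Suc n)"
    by (auto simp: M_def B_def)
  have "Determinant.det B = 1"
    by (subst det_upper_triangular[of _ "Suc n"])
       (auto simp: B_def intro!: prod_list_diag_mat_eq_1)
  then have "Determinant.det M = Determinant.det (M * B)"
    by (simp add: det_mult[of _ "Suc n"])
  also have MB: "M * B = Matrix.mat (Suc n) (Suc n)
     (\<lambda>(i, j). case j of 0 \<Rightarrow> M $$ (i, 0) | Suc l \<Rightarrow> M $$ (i, Suc l) - (z - x (Suc l)) * M $$ (i, l))"
    (is "_ = ?N")
  proof (rule eq_matI)
    fix i j assume "i < dim_row ?N" "j < dim_col ?N"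
    then have i: "i < Suc n" and j: "j < Suc n" by auto
    have "(M * B) $$ (i, j) = (\<Sum>l<Suc n. M $$ (i, l) * B $$ (l, j))"
      using i j carrier_matD[OF M] carrier_matD[OF B]
      by (simp add: scalar_prod_def atLeast0LessThan del: sum.lessThan_Suc)
    also have "\<dots> = ?N $$ (i, j)"
    proof (cases j)
      case 0
      have "(\<Sum>l<Suc n. M $$ (i, l) * B $$ (l, j)) = (\<Sum>l\<in>{0}. M $$ (i, l) * B $$ (l, j))"
        using j 0 by (intro sum.mono_neutral_right) (auto simp: B_def)
      with i j 0 show ?thesis by (simp add: B_def)
    next
      case (Suc l')
      have "(\<Sum>l<Suc n. M $$ (i, l) * B $$ (l, j)) = (\<Sum>l\<in>{l', Suc l'}. M $$ (i, l) * B $$ (l, j))"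
        using j Suc by (intro sum.mono_neutral_right) (auto simp: B_def)
      with i j Suc show ?thesis by (simp add: B_def algebra_simps)
    qed
    finally show "(M * B) $$ (i, j) = ?N $$ (i, j)" .
  qed (auto simp: M_def B_def)
  also have "Determinant.det ?N = (\<Sum>j<Suc n. ?N $$ (0, j) * cofactor ?N 0 j)"
    by (rule laplace_expansion_row) auto
  also have "\<dots> = (\<Sum>j\<in>{0}. ?N $$ (0, j) * cofactor ?N 0 j)"
    by (intro sum.mono_neutral_right) (auto simp: M_def psi_Suc simp del: One_nat_def split: nat.splits)
  also have "\<dots> = Determinant.det (mat_delete ?N 0 0)"
    by (simp add: cofactor_def) (simp add: M_def psi_0 del: One_nat_def)
  also have "mat_delete ?N 0 0
      = Matrix.mat n n (\<lambda>(i, j). A (Suc i) (Suc j) - (z - x (Suc j)) * A (Suc i) j)"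
    by (rule eq_matI) (auto simp: mat_delete_def M_def)
  finally show ?thesis unfolding M_def .
qed

text \<open>\<open>psi x 1 j\<close> is monic of degree \<open>j\<close>, so the Newton basis gives
  the Vandermonde determinant whatever the nodes \<open>x\<close> are. Clearing the first row at
  \<open>z = y 0\<close> leaves a factor \<open>y (Suc i) - y 0\<close> in each remaining row, and
  induction applies.\<close>

lemma det_psi:
  "Determinant.det (Matrix.mat n n (\<lambda>(i, j). psi x 1 j (y i))) = (\<Prod>j<n. \<Prod>i<j. y j - y i)"
proof (induction n arbitrary: y)
  case (Suc n)
  have "Matrix.mat (Suc n) (Suc n) (\<lambda>(i, j). psi x 1 j (y i))
      = Matrix.mat (Suc n) (Suc n) (\<lambda>(i, j). if i = 0 then psi x 1 j (y 0) else psi x 1 j (y i))"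
    by (rule eq_matI) auto
  then have "Determinant.det (Matrix.mat (Suc n) (Suc n) (\<lambda>(i, j). psi x 1 j (y i)))
     = Determinant.det (Matrix.mat n n (\<lambda>(i, j). psi x 1 (Suc j) (y (Suc i)) - (y 0 - x (Suc j)) * psi x 1 j (y (Suc i))))"
    by (simp only: det_first_row_psi)
  also have "\<dots> = Determinant.det (Matrix.mat n n (\<lambda>(i, j). (y (Suc i) - y 0) * psi x 1 j (y (Suc i))))"
    by (simp add: psi_Suc algebra_simps del: One_nat_def)
  also have "\<dots> = (\<Prod>i<n. y (Suc i) - y 0) * (\<Prod>j<n. \<Prod>i<j. y (Suc j) - y (Suc i))"
    by (simp only: det_row_factor Suc.IH)
  also have "\<dots> = (\<Prod>j<Suc n. \<Prod>i<j. y j - y i)"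
    by (simp add: prod.lessThan_Suc_shift prod.distrib del: prod.lessThan_Suc)
  finally show ?case .
qed simp

section \<open>Expansion of determinants by multilinearity in the rows\<close>

text \<open>Each row \<open>i\<close> picks one summand \<open>f i\<close>. Extensional functions
  make the set of choices finite, and the scalar picked in a row leaves the determinant as a row
  factor.\<close>

lemma det_sum_expand:
  fixes c b :: "nat \<Rightarrow> nat \<Rightarrow> complex"
  assumes "finite S"
  shows "Determinant.det (Matrix.mat n n (\<lambda>(i, j). \<Sum>s\<in>S. c i s * b s j))
    = (\<Sum>f\<in>PiE {0..<n} (\<lambda>_. S). (\<Prod>i<n. c i (f i)) * Determinant.det (Matrix.mat n n (\<lambda>(i, j). b (f i) j)))"
    (is "?L = ?R")
proof -
  let ?P = "{\<pi>. \<pi> permutes {0..<n}}"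
  have lt: "\<pi> i < n" if "\<pi> permutes {0..<n}" "i < n" for \<pi> i
    using permutes_in_image[OF that(1), of i] that by auto
  have "?L = (\<Sum>\<pi>\<in>?P. signof \<pi> * (\<Prod>i = 0..<n. \<Sum>s\<in>S. c i s * b s (\<pi> i)))"
    using lt by (auto simp: det_def'[of _ n] intro!: sum.cong)
  also have "\<dots> = (\<Sum>\<pi>\<in>?P. \<Sum>f\<in>PiE {0..<n} (\<lambda>_. S). signof \<pi> * (\<Prod>i = 0..<n. c i (f i) * b (f i) (\<pi> i)))"
    using assms by (simp add: prod_sum_PiE sum_distrib_left)
  also have "\<dots> = (\<Sum>f\<in>PiE {0..<n} (\<lambda>_. S). \<Sum>\<pi>\<in>?P. signof \<pi> * (\<Prod>i = 0..<n. c i (f i) * b (f i) (\<pi> i)))"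
    by (rule sum.swap)
  also have "\<dots> = ?R"
  proof (rule sum.cong[OF refl])
    fix f
    have "Determinant.det (Matrix.mat n n (\<lambda>(i, j). c i (f i) * b (f i) j))
        = (\<Sum>\<pi>\<in>?P. signof \<pi> * (\<Prod>i = 0..<n. c i (f i) * b (f i) (\<pi> i)))"
      using lt by (auto simp: det_def'[of _ n] intro!: sum.cong)
    then show "(\<Sum>\<pi>\<in>?P. signof \<pi> * (\<Prod>i = 0..<n. c i (f i) * b (f i) (\<pi> i)))
        = (\<Prod>i<n. c i (f i)) * Determinant.det (Matrix.mat n n (\<lambda>(i, j). b (f i) j))"
      by (simp add: det_row_factor)
  qed
  finally show ?thesis .
qed

text \<open>The first term collects the choices with all values below \<open>n\<close>; by multiplicativity of the
  determinant no expansion over permutations is needed.\<close>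

lemma det_sum_split:
  fixes c b :: "nat \<Rightarrow> nat \<Rightarrow> complex"
  assumes "finite S" and n: "{0..<n} \<subseteq> S"
  shows "Determinant.det (Matrix.mat n n (\<lambda>(i, j). \<Sum>s\<in>S. c i s * b s j))
    = Determinant.det (Matrix.mat n n (\<lambda>(i, j). c i j)) * Determinant.det (Matrix.mat n n (\<lambda>(i, j). b i j))
      + (\<Sum>f\<in>PiE {0..<n} (\<lambda>_. S) - PiE {0..<n} (\<lambda>_. {0..<n}).
           (\<Prod>i<n. c i (f i)) * Determinant.det (Matrix.mat n n (\<lambda>(i, j). b (f i) j)))"
proof -
  let ?w = "\<lambda>f. (\<Prod>i<n. c i (f i)) * Determinant.det (Matrix.mat n n (\<lambda>(i, j). b (f i) j))"
  have "Matrix.mat n n (\<lambda>(i, j). c i j) * Matrix.mat n n (\<lambda>(i, j). b i j)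
      = Matrix.mat n n (\<lambda>(i, j). \<Sum>s\<in>{0..<n}. c i s * b s j)"
    by (rule eq_matI) (auto simp: scalar_prod_def)
  then have "Determinant.det (Matrix.mat n n (\<lambda>(i, j). c i j)) * Determinant.det (Matrix.mat n n (\<lambda>(i, j). b i j))
      = Determinant.det (Matrix.mat n n (\<lambda>(i, j). \<Sum>s\<in>{0..<n}. c i s * b s j))"
    by (simp flip: det_mult[of _ n])
  also have "\<dots> = sum ?w (PiE {0..<n} (\<lambda>_. {0..<n}))"
    by (rule det_sum_expand) simp
  finally have *: "sum ?w (PiE {0..<n} (\<lambda>_. {0..<n}))
    = Determinant.det (Matrix.mat n n (\<lambda>(i, j). c i j)) * Determinant.det (Matrix.mat n n (\<lambda>(i, j). b i j))" ..
  have "PiE {0..<n} (\<lambda>_. {0..<n}) \<subseteq> PiE {0..<n} (\<lambda>_. S)" using n by (intro PiE_mono) auto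
  then show ?thesis
    unfolding det_sum_expand[OF assms(1)] * [symmetric]
    using sum.subset_diff[of "PiE {0..<n} (\<lambda>_. {0..<n})" "PiE {0..<n} (\<lambda>_. S)" ?w] assms(1)
    by (simp add: finite_PiE add.commute)
qed

section \<open>The determinant \<open>Q\<close> and the linear system for the coefficients\<close>

text \<open>This brings \<open>Q\<close> to the size of the system determinant. Once the entries are
  sums over poles, the combination of adjacent columns merely contributes a factor
  \<open>zs s - z\<close> to each summand.\<close>

lemma itea_Q_eq_det:
  "itea_Q u x k z = Determinant.det (Matrix.mat k k (\<lambda>(i, j). u (i + 1) (j + 1) - (z - x (j + 1)) * u (i + 1) j))"
  unfolding itea_Q_def using det_first_row_psi[of k x z u] by simp

text \<open>The definite description in \<open>itea_coeffs\<close> is justified here: Cramer's rule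
  gives existence, the trivial kernel of the system matrix gives uniqueness.\<close>

lemma itea_coeffs:
  assumes det: "Determinant.det (itea_system u k) \<noteq> 0"
  shows "itea_coeffs u k k = 1" and "i \<in> {1..k} \<Longrightarrow> (\<Sum>j<k. u i j * itea_coeffs u k j) = - u i k"
proof -
  define A where "A = itea_system u k"
  have A [simp]: "A \<in> carrier_mat k k" by (simp add: A_def itea_system_def)
  have Av: "vec_index (A *\<^sub>v y) i = (\<Sum>j<k. u (Suc i) j * vec_index y j)" if "i < k" "y \<in> carrier_vec k" for y i
    using that by (simp add: A_def itea_system_def scalar_prod_def atLeast0LessThan)
  define P where "P = (\<lambda>c. (\<forall>j>k. c j = 0) \<and> c k = 1 \<and> (\<forall>i\<in>{1..k}. (\<Sum>j<k. u i j * c j) = - u i k))"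
  define b where "b = Matrix.vec k (\<lambda>i. - u (Suc i) k)"
  \<comment> \<open>Cramer's rule: the adjugate divided by the determinant is the inverse
    matrix.\<close>
  define y where "y = (1 / Determinant.det A) \<cdot>\<^sub>v (adj_mat A *\<^sub>v b)"
  have y: "y \<in> carrier_vec k" "b \<in> carrier_vec k" using adj_mat(1)[OF A] by (auto simp: y_def b_def)
  have "A *\<^sub>v y = (1 / Determinant.det A) \<cdot>\<^sub>v (A *\<^sub>v (adj_mat A *\<^sub>v b))"
    unfolding y_def using adj_mat(1)[OF A] y by (intro mult_mat_vec[of _ k k]) auto
  also have "A *\<^sub>v (adj_mat A *\<^sub>v b) = (A * adj_mat A) *\<^sub>v b"
    using adj_mat(1)[OF A] y by (simp add: assoc_mult_mat_vec[of _ k k _ k])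
  also have "\<dots> = Determinant.det A \<cdot>\<^sub>v b"
    using y unfolding adj_mat(2)[OF A] by (intro eq_vecI) (auto simp: row_smult)
  finally have Ay: "A *\<^sub>v y = b" using det y by (simp add: smult_smult_assoc A_def)
  define c where "c = (\<lambda>j. if j < k then vec_index y j else if j = k then 1 else 0)"
  have "P c"
    unfolding P_def
  proof (intro conjI ballI)
    fix i assume i: "i \<in> {1..k}"
    have "(\<Sum>j<k. u i j * c j) = vec_index (A *\<^sub>v y) (i - 1)"
      using i y by (subst Av) (auto simp: c_def)
    also have "\<dots> = - u i k" using i unfolding Ay by (auto simp: b_def)
    finally show "(\<Sum>j<k. u i j * c j) = - u i k" .
  qed (auto simp: c_def)
  moreover have "c' = c" if "P c'" for c'
  proof -
    \<comment> \<open>The difference of two solutions solves the homogeneous system; from index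
      \<open>k\<close> on they agree by normalization.\<close>
    define w where "w = Matrix.vec k (\<lambda>j. c' j - c j)"
    have "A *\<^sub>v w = 0\<^sub>v k"
    proof (rule eq_vecI)
      fix i assume "i < dim_vec (0\<^sub>v k :: complex Matrix.vec)"
      then have i: "i < k" by simp
      have "(\<Sum>j<k. u (Suc i) j * c' j) = - u (Suc i) k" "(\<Sum>j<k. u (Suc i) j * c j) = - u (Suc i) k"
        using \<open>P c'\<close> \<open>P c\<close> i unfolding P_def by auto
      then show "vec_index (A *\<^sub>v w) i = vec_index (0\<^sub>v k) i"
        using i by (simp add: Av w_def right_diff_distrib sum_subtractf)
    qed (auto simp: A_def itea_system_def)
    moreover have "w \<in> carrier_vec k" by (simp add: w_def)
    ultimately have w: "w = 0\<^sub>v k"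
      using det det_0_iff_vec_prod_zero[OF A] by (auto simp: A_def)
    show "c' = c"
    proof
      fix j
      show "c' j = c j"
      proof (cases "j < k")
        case True
        have "vec_index w j = 0" using True unfolding w by simp
        with True show ?thesis by (simp add: w_def)
      qed (use \<open>P c'\<close> \<open>P c\<close> in \<open>auto simp: P_def not_less le_less\<close>)
    qed
  qed
  ultimately have "P (THE c. P c)" by (rule theI)
  then have "P (itea_coeffs u k)" by (simp add: itea_coeffs_def P_def)
  then show "itea_coeffs u k k = 1" "i \<in> {1..k} \<Longrightarrow> (\<Sum>j<k. u i j * itea_coeffs u k j) = - u i k"
    by (auto simp: P_def)
qed

text \<open>Adding \<open>c j\<close> times column \<open>j\<close> to the last column, for all \<open>j < k\<close>, leaves only its first entry.\<close>

lemma itea_Q_eq_itea_denom: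
  assumes det: "Determinant.det (itea_system u k) \<noteq> 0"
  shows "itea_Q u x k z = (-1) ^ k * itea_denom u x k z * Determinant.det (itea_system u k)"
proof -
  let ?c = "itea_coeffs u k"
  define M where "M = Matrix.mat (Suc k) (Suc k) (\<lambda>(i, j). if i = 0 then psi x 1 j z else u i j)"
  define B where "B = Matrix.mat (Suc k) (Suc k) (\<lambda>(i, j). if j = k then ?c i else if i = j then 1 else 0)"
  define N where "N = Matrix.mat (Suc k) (Suc k)
     (\<lambda>(i, j). if j = k then if i = 0 then itea_denom u x k z else 0 else M $$ (i, j))"
  have M [simp]: "M \<in> carrier_mat (Suc k) (Suc k)" and B [simp]: "B \<in> carrier_mat (Suc k) (Suc k)"
    and N [simp]: "N \<in> carrier_mat (Suc k) (Suc k)"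
    by (auto simp: M_def B_def N_def)
  \<comment> \<open>The normalization \<open>c k = 1\<close> completes the unit diagonal, so
    multiplying by \<open>B\<close> preserves the determinant.\<close>
  have "Determinant.det B = 1"
    using itea_coeffs(1)[OF det] by (subst det_upper_triangular[of _ "Suc k"])
       (auto simp: B_def intro!: prod_list_diag_mat_eq_1)
  then have "itea_Q u x k z = Determinant.det (M * B)"
    by (simp add: det_mult[of _ "Suc k"] itea_Q_def M_def)
  also have "M * B = N"
  proof (rule eq_matI)
    fix i j assume "i < dim_row N" "j < dim_col N"
    then have i: "i < Suc k" and j: "j < Suc k" by (auto simp: N_def)
    have "(M * B) $$ (i, j) = (\<Sum>l<Suc k. M $$ (i, l) * B $$ (l, j))"
      using i j carrier_matD[OF M] carrier_matD[OF B]
      by (simp add: scalar_prod_def atLeast0LessThan del: sum.lessThan_Suc)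
    also have "\<dots> = N $$ (i, j)"
    proof (cases "j = k")
      case False
      have "(\<Sum>l<Suc k. M $$ (i, l) * B $$ (l, j)) = (\<Sum>l\<in>{j}. M $$ (i, l) * B $$ (l, j))"
        using j False by (intro sum.mono_neutral_right) (auto simp: B_def)
      with i j False show ?thesis by (simp add: B_def N_def)
    next
      case True
      show ?thesis
      proof (cases "i = 0")
        case True
        with \<open>j = k\<close> show ?thesis
          by (simp add: B_def N_def M_def itea_denom_def mult.commute lessThan_Suc_atMost del: sum.lessThan_Suc sum.atMost_Suc)
      next
        case False
        with \<open>j = k\<close> i itea_coeffs[OF det] show ?thesis
          by (simp add: B_def N_def M_def)
      qed
    qed
    finally show "(M * B) $$ (i, j) = N $$ (i, j)" .
  qed (auto simp: M_def B_def N_def)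
  also have "Determinant.det N = (\<Sum>i<Suc k. N $$ (i, k) * cofactor N i k)"
    by (rule laplace_expansion_column) auto
  also have "\<dots> = (\<Sum>i\<in>{0}. N $$ (i, k) * cofactor N i k)"
    by (intro sum.mono_neutral_right) (auto simp: N_def)
  also have "\<dots> = itea_denom u x k z * ((-1) ^ k * Determinant.det (mat_delete N 0 k))"
    by (simp add: cofactor_def) (simp add: N_def)
  also have "mat_delete N 0 k = itea_system u k"
    by (rule eq_matI) (auto simp: mat_delete_def N_def M_def itea_system_def)
  finally show ?thesis by (simp add: mult_ac)
qed

text \<open>Reading the nodes backwards turns a product over final nodes into one over initial
  nodes, the shape that \<open>det_psi\<close> handles.\<close>

lemma psi_reverse:
  assumes "i < k"
  shows "psi x (p + (i + 1) + 1) (p + k) z = psi (\<lambda>r. x (p + k + 1 - r)) 1 (k - 1 - i) z"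
  unfolding psi_def
  by (rule prod.reindex_bij_witness[of _ "\<lambda>r. p + k + 1 - r" "\<lambda>r. p + k + 1 - r"]) (use assms in auto)

text \<open>The entries are Newton polynomials of degree \<open>k - 1 - i\<close> at reversed nodes, so the rows are those of a
  Vandermonde matrix in reverse order.\<close>

lemma T_det_eq:
  "T_det ip q v zs x p k (\<lambda>j. j)
   = signof (\<lambda>i. if i < k then k - 1 - i else i) * (\<Prod>i<k. ip q (v (Suc i))) * (\<Prod>j<k. \<Prod>i<j. zs (Suc j) - zs (Suc i))"
proof -
  define \<rho> where "\<rho> = (\<lambda>i. if i < k then k - 1 - i else i)"
  define x' where "x' = (\<lambda>r. x (p + k + 1 - r))"
  define A where "A = Matrix.mat k k (\<lambda>(i, j). psi x' 1 i (zs (Suc j)))"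
  \<comment> \<open>The reversal of the rows is its own inverse.\<close>
  have \<rho>: "\<rho> permutes {0..<k}"
    by (rule bij_imp_permutes, rule bij_betw_byWitness[where f' = \<rho>]) (auto simp: \<rho>_def)
  have "T_det ip q v zs x p k (\<lambda>j. j)
      = Determinant.det (Matrix.mat k k (\<lambda>(i, j). psi x (p + (i + 1) + 1) (p + k) (zs (Suc j)) * ip q (v (Suc j))))"
    by (simp add: T_det_def alpha_def mult.commute)
  also have "\<dots> = Determinant.det (Matrix.mat k k (\<lambda>(i, j). psi x (p + (i + 1) + 1) (p + k) (zs (Suc j)))) * (\<Prod>i<k. ip q (v (Suc i)))"
    by (rule det_col_factor)
  also have "Matrix.mat k k (\<lambda>(i, j). psi x (p + (i + 1) + 1) (p + k) (zs (Suc j))) = Matrix.mat k k (\<lambda>(i, j). A $$ (\<rho> i, j))"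
    by (rule eq_matI) (auto simp: A_def \<rho>_def psi_reverse x'_def simp del: One_nat_def)
  also have "Determinant.det \<dots> = signof \<rho> * Determinant.det A"
    by (rule det_permute_rows[OF _ \<rho>]) (simp add: A_def)
  also have "Determinant.det A = Determinant.det (Matrix.mat k k (\<lambda>(i, j). psi x' 1 j (zs (Suc i))))"
    unfolding A_def by (subst det_transpose[of _ k, symmetric]) (auto intro!: arg_cong[where f = Determinant.det])
  also have "\<dots> = (\<Prod>j<k. \<Prod>i<j. zs (Suc j) - zs (Suc i))"
    by (rule det_psi)
  finally show ?thesis by (simp add: \<rho>_def mult_ac)
qed

subsection \<open>Divided differences of rational functions\<close>

lemma equal_points_consecutiveD:
  assumes "equal_points_consecutive x N" "1 \<le> m" "m + n \<le> N" "x m = x (m + n)" "m \<le> j" "j \<le> m + n"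
  shows "x j = x m"
  using assms(1)[unfolded equal_points_consecutive_def, rule_format, of m j "m + n"] assms(2-) by simp

text \<open>Cleared of the denominator, the recurrence survives coinciding end nodes: all nodes
  between are then equal, and both differences of order \<open>n\<close> are the same derivative
  term.\<close>

lemma divdiff_step:
  assumes x: "equal_points_consecutive x N" and m: "1 \<le> m" "m + Suc n \<le> N"
  shows "divdiff f x (Suc m) n - divdiff f x m n = (x (m + Suc n) - x m) * divdiff f x m (Suc n)"
proof (cases "x m = x (m + Suc n)")
  case True
  have eq: "x j = x m" if "m \<le> j" "j \<le> m + Suc n" for j
    using equal_points_consecutiveD[OF x m True that] .
  have "divdiff f x (Suc m) n = divdiff f x m n"
    using eq[of "Suc m"] eq[of "m + n"] eq[of "Suc m + n"] by (cases n) auto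
  with True show ?thesis by simp
qed auto

text \<open>Leibniz rule; only two terms remain because the second derivative of the identity
  vanishes. It settles the confluent case of \<open>divdiff_times_ident\<close>.\<close>

lemma higher_deriv_times_ident:
  assumes f: "f holomorphic_on UNIV"
  shows "(deriv ^^ Suc n) (\<lambda>z. z * f z) w = w * (deriv ^^ Suc n) f w + of_nat (Suc n) * (deriv ^^ n) f w"
proof (induction n arbitrary: w)
  case 0
  have "(f has_field_derivative deriv f w) (at w)"
    using f by (simp add: holomorphic_derivI)
  then have "((\<lambda>z. z * f z) has_field_derivative (w * deriv f w + f w)) (at w)"
    by (auto intro!: derivative_eq_intros)
  then show ?case by (simp add: DERIV_imp_deriv)
next
  case (Suc n)
  have D: "((deriv ^^ j) f has_field_derivative (deriv ^^ Suc j) f w) (at w)" for j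
    using holomorphic_derivI[OF holomorphic_higher_deriv[OF f open_UNIV, of j] open_UNIV, of w] by simp
  \<comment> \<open>The induction hypothesis holds at every point, hence is an equation of functions
    that may be differentiated.\<close>
  have "(deriv ^^ Suc (Suc n)) (\<lambda>z. z * f z) w = deriv (\<lambda>w. w * (deriv ^^ Suc n) f w + of_nat (Suc n) * (deriv ^^ n) f w) w"
    using ext[of "(deriv ^^ Suc n) (\<lambda>z. z * f z)", OF Suc.IH] by (simp del: funpow.simps add: funpow.simps(2)[of "Suc n"])
  also have "\<dots> = w * (deriv ^^ Suc (Suc n)) f w + of_nat (Suc (Suc n)) * (deriv ^^ Suc n) f w"
  proof (rule DERIV_imp_deriv)
    have "((\<lambda>w. w * (deriv ^^ Suc n) f w + of_nat (Suc n) * (deriv ^^ n) f w) has_field_derivative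
        1 * (deriv ^^ Suc n) f w + (deriv ^^ Suc (Suc n)) f w * w + of_nat (Suc n) * (deriv ^^ Suc n) f w) (at w)"
      by (intro DERIV_add DERIV_mult DERIV_ident DERIV_cmult D)
    then show "((\<lambda>w. w * (deriv ^^ Suc n) f w + of_nat (Suc n) * (deriv ^^ n) f w) has_field_derivative
        w * (deriv ^^ Suc (Suc n)) f w + of_nat (Suc (Suc n)) * (deriv ^^ Suc n) f w) (at w)"
      by (simp add: algebra_simps del: funpow.simps)
  qed
  finally show ?case .
qed

text \<open>The Leibniz rule for divided differences when one factor is the identity. It lets powers
  be treated by induction on the exponent.\<close>

lemma divdiff_times_ident:
  assumes f: "f holomorphic_on UNIV" and x: "equal_points_consecutive x N"
    and m: "1 \<le> m" "m + Suc n \<le> N"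
  shows "divdiff (\<lambda>z. z * f z) x m (Suc n) = x m * divdiff f x m (Suc n) + divdiff f x (Suc m) n"
  using m
proof (induction n arbitrary: m)
  case 0
  have "deriv (\<lambda>z. z * f z) w = w * deriv f w + f w" for w
    using higher_deriv_times_ident[OF f, of 0 w] by simp
  with 0 show ?case by (auto simp: field_simps)
next
  case (Suc n)
  show ?case
  proof (cases "x m = x (m + Suc (Suc n))")
    case True
    have eq: "x j = x m" if "m \<le> j" "j \<le> m + Suc (Suc n)" for j
      using equal_points_consecutiveD[OF x Suc.prems True that] .
    have "divdiff f x (Suc m) (Suc n) = (deriv ^^ Suc n) f (x m) / fact (Suc n)"
      using eq[of "Suc m"] True by simp
    moreover have "divdiff h x m (Suc (Suc n)) = (deriv ^^ Suc (Suc n)) h (x m) / fact (Suc (Suc n))" for h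
      using True by simp
    moreover have "of_nat (Suc (Suc n)) * w / fact (Suc (Suc n)) = w / fact (Suc n)" for w :: complex
      by (simp add: field_simps del: of_nat_Suc)
    ultimately show ?thesis
      by (simp only: higher_deriv_times_ident[OF f] add_divide_distrib times_divide_eq_right)
  next
    case False
    define a b where "a = x m" and "b = x (m + Suc (Suc n))"
    have ab: "b - a \<noteq> 0" using False by (simp add: a_def b_def)
    define f1 where "f1 = divdiff f x (Suc m) (Suc n)"
    define f0 where "f0 = divdiff f x m (Suc n)"
    have "divdiff (\<lambda>z. z * f z) x m (Suc (Suc n))
        = ((x (Suc m) * f1 + divdiff f x (Suc (Suc m)) n) - (a * f0 + divdiff f x (Suc m) n)) / (b - a)"
      using False Suc.IH[of m] Suc.IH[of "Suc m"] Suc.prems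
      by (simp add: a_def b_def f0_def f1_def del: divdiff.simps add: divdiff.simps(2)[of _ x m "Suc n"])
    \<comment> \<open>Rewriting the difference that starts two nodes later makes
      \<open>divdiff f x (Suc m) n\<close> cancel and removes \<open>x (Suc m)\<close>.\<close>
    also have "divdiff f x (Suc (Suc m)) n = divdiff f x (Suc m) n + (b - x (Suc m)) * f1"
      using divdiff_step[OF x, of "Suc m" n f] Suc.prems
      by (simp add: b_def f1_def algebra_simps del: divdiff.simps)
    also have "((x (Suc m) * f1 + (divdiff f x (Suc m) n + (b - x (Suc m)) * f1)) - (a * f0 + divdiff f x (Suc m) n)) / (b - a)
        = a * ((f1 - f0) / (b - a)) + f1"
      using ab by (simp add: field_simps)
    also have "(f1 - f0) / (b - a) = divdiff f x m (Suc (Suc n))"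
      using False by (simp add: f0_def f1_def a_def b_def del: divdiff.simps add: divdiff.simps(2)[of _ x m "Suc n"])
    finally show ?thesis by (simp only: a_def f1_def)
  qed
qed

lemma divdiff_const: "divdiff (\<lambda>_. c) x m (Suc n) = 0"
proof (induction n arbitrary: m)
  case (Suc n)
  then show ?case
    by (subst divdiff.simps(2)) (simp only: higher_deriv_const, simp del: divdiff.simps)
qed simp

text \<open>Splitting off one factor \<open>z\<close> lowers the exponent by one and the order by at
  most one, so the order stays above the exponent until a constant is reached.\<close>

lemma divdiff_power_eq_0:
  assumes x: "equal_points_consecutive x N" and "1 \<le> m" "m + n \<le> N" "l < n"
  shows "divdiff (\<lambda>z. z ^ l) x m n = 0"
  using assms(2-)
proof (induction l arbitrary: m n)
  case 0
  then show ?case using divdiff_const[of 1 x m "n - 1"] by simp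
next
  case (Suc l)
  then obtain n' where n: "n = Suc n'" by (cases n) auto
  have "divdiff (\<lambda>z. z * z ^ l) x m (Suc n') = x m * divdiff (\<lambda>z. z ^ l) x m (Suc n') + divdiff (\<lambda>z. z ^ l) x (Suc m) n'"
    using Suc.prems n by (intro divdiff_times_ident[OF _ x] holomorphic_intros) auto
  then show ?case using Suc.IH[of m n] Suc.IH[of "Suc m" n'] Suc.prems n
    by (simp del: divdiff.simps)
qed

text \<open>With \<open>c - w\<close> in place of \<open>w - c\<close> the sign is the same for
  every \<open>n\<close>, which matches the factors of \<open>psi\<close> at
  \<open>c\<close>.\<close>

lemma higher_deriv_pole:
  fixes c w :: complex
  assumes "w \<noteq> c"
  shows "(deriv ^^ n) (\<lambda>z. 1 / (z - c)) w = - fact n / (c - w) ^ Suc n"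
  using assms
proof (induction n arbitrary: w)
  case 0
  then show ?case by (simp add: field_simps)
next
  case (Suc n)
  \<comment> \<open>The points other than \<open>c\<close> form an open set, so the induction
    hypothesis holds near \<open>w\<close> and not only at \<open>w\<close>.\<close>
  have "eventually (\<lambda>z. (deriv ^^ n) (\<lambda>z. 1 / (z - c)) z = - fact n / (c - z) ^ Suc n) (nhds w)"
    using eventually_mono[OF t1_space_nhds[OF Suc.prems] Suc.IH] .
  then have "deriv ((deriv ^^ n) (\<lambda>z. 1 / (z - c))) w = deriv (\<lambda>z. - fact n / (c - z) ^ Suc n) w"
    by (rule deriv_cong_ev) (rule refl)
  also have "\<dots> = - fact (Suc n) / (c - w) ^ Suc (Suc n)"
  proof (rule DERIV_imp_deriv)
    define y where "y = c - w"
    have y: "y \<noteq> 0" using Suc.prems by (simp add: y_def)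
    have "((\<lambda>z. (c - z) ^ Suc n) has_field_derivative of_nat (Suc n) * (0 - 1) * (c - w) ^ (Suc n - 1)) (at w)"
      by (rule derivative_eq_intros refl)+ (simp add: algebra_simps)
    then have "((\<lambda>z. - fact n / (c - z) ^ Suc n) has_field_derivative
        (0 * (c - w) ^ Suc n - (- fact n) * (of_nat (Suc n) * (0 - 1) * (c - w) ^ (Suc n - 1))) / ((c - w) ^ Suc n * (c - w) ^ Suc n)) (at w)"
      using Suc.prems by (intro DERIV_divide DERIV_const) auto
    also have "(0 * (c - w) ^ Suc n - (- fact n) * (of_nat (Suc n) * (0 - 1) * (c - w) ^ (Suc n - 1))) / ((c - w) ^ Suc n * (c - w) ^ Suc n)
        = - fact (Suc n) / (c - w) ^ Suc (Suc n)"
      unfolding y_def [symmetric] using y by (simp add: divide_simps) (simp add: algebra_simps)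
    finally show "((\<lambda>z. - fact n / (c - z) ^ Suc n) has_field_derivative - fact (Suc n) / (c - w) ^ Suc (Suc n)) (at w)" .
  qed
  finally show ?case by simp
qed

lemma psi_Suc_left: "psi x m (m + Suc n) c = (c - x m) * psi x (Suc m) (m + Suc n) c"
  unfolding psi_def by (subst prod.atLeast_Suc_atMost) auto

lemma psi_Suc_right: "psi x m (m + Suc n) c = (c - x (m + Suc n)) * psi x m (m + n) c"
  unfolding psi_def by (simp add: mult.commute)

lemma psi_nonzero:
  assumes "\<And>i. 1 \<le> i \<Longrightarrow> i \<le> N \<Longrightarrow> x i \<noteq> c" "1 \<le> a" "b \<le> N"
  shows "psi x a b c \<noteq> 0"
  unfolding psi_def prod_zero_iff[OF finite_atLeastAtMost]
proof
  assume "\<exists>r\<in>{a..b}. c - x r = 0"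
  then obtain r where "a \<le> r" "r \<le> b" "c = x r" by auto
  with assms(1)[of r] assms(2,3) show False by simp
qed

text \<open>If all nodes coincide this is the derivative formula for a simple pole. Otherwise the
  recurrence collapses, since dropping the first or the last node factors the same product in two
  ways.\<close>

lemma divdiff_pole:
  assumes x: "equal_points_consecutive x N" and m: "1 \<le> m" "m + n \<le> N" and c: "\<And>i. 1 \<le> i \<Longrightarrow> i \<le> N \<Longrightarrow> x i \<noteq> c"
  shows "divdiff (\<lambda>z. 1 / (z - c)) x m n = - 1 / psi x m (m + n) c"
  using m
proof (induction n arbitrary: m)
  case 0
  have "1 / (x m - c) = - 1 / (c - x m)" by (metis minus_diff_eq minus_divide_divide)
  then show ?case by (simp add: psi_def)
next
  case (Suc n)
  show ?case
  proof (cases "x m = x (m + Suc n)")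
    case True
    have "psi x m (m + Suc n) c = (\<Prod>r = m..m + Suc n. c - x m)"
      unfolding psi_def
    proof (rule prod.cong[OF refl])
      fix r assume "r \<in> {m..m + Suc n}"
      then have "x r = x m" by (intro equal_points_consecutiveD[OF x Suc.prems True]) auto
      then show "c - x r = c - x m" by simp
    qed
    also have "\<dots> = (c - x m) ^ Suc (Suc n)" by simp
    finally have "psi x m (m + Suc n) c = (c - x m) ^ Suc (Suc n)" .
    moreover have "(deriv ^^ Suc n) (\<lambda>z. 1 / (z - c)) (x m) = - fact (Suc n) / (c - x m) ^ Suc (Suc n)"
      using c[of m] Suc.prems by (intro higher_deriv_pole) auto
    moreover have "- fact (Suc n) / y / fact (Suc n) = - 1 / y" for y :: complex
      by (simp del: fact_Suc)
    ultimately show ?thesis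
      by (simp only: divdiff.simps(2) if_P[OF True])
  next
    case False
    define a b P1 P0 where "a = x m" and "b = x (m + Suc n)"
      and "P1 = psi x (Suc m) (Suc m + n) c" and "P0 = psi x m (m + n) c"
    \<comment> \<open>The second equation expresses \<open>P1 - P0\<close> through
      \<open>b - a\<close>, which cancels the denominator of the recurrence.\<close>
    have P: "psi x m (m + Suc n) c = (c - a) * P1" "(c - a) * P1 = (c - b) * P0"
      using psi_Suc_left[of x m n c] psi_Suc_right[of x m n c] by (simp_all add: P1_def P0_def a_def b_def)
    have nz': "c - a \<noteq> 0" "P1 \<noteq> 0" "P0 \<noteq> 0" "b - a \<noteq> 0"
      using c[of m] psi_nonzero[OF c, where a = m and b = "m + n"]
        psi_nonzero[OF c, where a = "Suc m" and b = "Suc m + n"] Suc.prems False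
      by (auto simp: P1_def P0_def a_def b_def)
    have IH: "divdiff (\<lambda>z. 1 / (z - c)) x m n = - 1 / P0" "divdiff (\<lambda>z. 1 / (z - c)) x (Suc m) n = - 1 / P1"
      using Suc.IH[of m] Suc.IH[of "Suc m"] Suc.prems by (simp_all add: P1_def P0_def)
    have "divdiff (\<lambda>z. 1 / (z - c)) x m (Suc n) = (- 1 / P1 - - 1 / P0) / (b - a)"
      unfolding divdiff.simps(2) IH using False by (simp only: a_def b_def if_False)
    also have "\<dots> = (P1 - P0) / (P0 * P1) / (b - a)"
      using nz' by (simp add: divide_simps)
    also have "\<dots> = - 1 / ((c - a) * P1)"
    proof -
      have "(P1 - P0) * (c - a) = - ((b - a) * P0)"
        using P(2) by (simp add: algebra_simps)
      then have *: "(P1 - P0) * ((c - a) * P1) = - 1 * (P0 * P1 * (b - a))"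
        by (simp flip: mult.assoc)
      have "P0 * P1 * (b - a) \<noteq> 0" "(c - a) * P1 \<noteq> 0" using nz' by auto
      from iffD2[OF frac_eq_eq[OF this] *] show ?thesis
        by (simp only: divide_divide_eq_left)
    qed
    finally show ?thesis by (simp only: P(1))
  qed
qed

section \<open>Locality and linearity of divided differences\<close>

text \<open>Confluent nodes involve derivatives, so agreement at the nodes alone does not suffice.
  The lemma allows \<open>F\<close> to be replaced by its formula, which is known only off the
  poles.\<close>

lemma divdiff_cong:
  assumes "open U" "\<And>z. z \<in> U \<Longrightarrow> f z = g z" "\<And>i. m \<le> i \<Longrightarrow> i \<le> m + n \<Longrightarrow> x i \<in> U"
  shows "divdiff f x m n = divdiff g x m n"
  using assms(3)
proof (induction n arbitrary: m)
  case 0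
  then show ?case using assms(2) by simp
next
  case (Suc n)
  have "\<forall>\<^sub>F z in nhds (x m). f z = g z"
    using assms(1,2) Suc.prems[of m] by (auto simp: eventually_nhds)
  then have "(deriv ^^ Suc n) f (x m) = (deriv ^^ Suc n) g (x m)"
    by (rule higher_deriv_cong_ev) simp
  moreover have "divdiff f x m n = divdiff g x m n" "divdiff f x (Suc m) n = divdiff g x (Suc m) n"
    using Suc by auto
  ultimately show ?case by (simp only: divdiff.simps(2))
qed

lemma divdiff_add:
  assumes "open U" "f holomorphic_on U" "g holomorphic_on U" "\<And>i. m \<le> i \<Longrightarrow> i \<le> m + n \<Longrightarrow> x i \<in> U"
  shows "divdiff (\<lambda>z. f z + g z) x m n = divdiff f x m n + divdiff g x m n"
  using assms(4)
proof (induction n arbitrary: m)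
  case (Suc n)
  have D: "(deriv ^^ Suc n) (\<lambda>z. f z + g z) (x m) = (deriv ^^ Suc n) f (x m) + (deriv ^^ Suc n) g (x m)"
    using assms(1-3) Suc.prems[of m] by (intro higher_deriv_add) auto
  have IH: "divdiff (\<lambda>z. f z + g z) x m n = divdiff f x m n + divdiff g x m n"
    "divdiff (\<lambda>z. f z + g z) x (Suc m) n = divdiff f x (Suc m) n + divdiff g x (Suc m) n"
    using Suc by auto
  show ?case
    unfolding divdiff.simps(2) D IH by (simp add: add_divide_distrib diff_divide_distrib del: funpow.simps fact_Suc)
qed simp

lemma divdiff_cmult:
  assumes "open U" "f holomorphic_on U" "\<And>i. m \<le> i \<Longrightarrow> i \<le> m + n \<Longrightarrow> x i \<in> U"
  shows "divdiff (\<lambda>z. c * f z) x m n = c * divdiff f x m n"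
  using assms(3)
proof (induction n arbitrary: m)
  case (Suc n)
  have D: "(deriv ^^ Suc n) (\<lambda>z. c * f z) (x m) = c * (deriv ^^ Suc n) f (x m)"
    using assms(1,2) Suc.prems[of m] by (intro higher_deriv_cmult) auto
  have IH: "divdiff (\<lambda>z. c * f z) x m n = c * divdiff f x m n"
    "divdiff (\<lambda>z. c * f z) x (Suc m) n = c * divdiff f x (Suc m) n"
    using Suc by auto
  show ?case
    unfolding divdiff.simps(2) D IH by (simp add: right_diff_distrib diff_divide_distrib del: funpow.simps fact_Suc)
qed simp

lemma divdiff_sum:
  assumes "finite S" "open U" "\<And>s. s \<in> S \<Longrightarrow> f s holomorphic_on U"
    "\<And>i. m \<le> i \<Longrightarrow> i \<le> m + n \<Longrightarrow> x i \<in> U"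
  shows "divdiff (\<lambda>z. \<Sum>s\<in>S. c s * f s z) x m n = (\<Sum>s\<in>S. c s * divdiff (f s) x m n)"
  using assms(1,3)
proof (induction S rule: finite_induct)
  case empty
  \<comment> \<open>Writing the zero function as a multiple by \<open>0\<close> lets homogeneity
    show that its differences vanish.\<close>
  have "divdiff (\<lambda>_. 0 * 0) x m n = 0 * divdiff (\<lambda>_. 0) x m n"
    using assms(2,4) by (intro divdiff_cmult[of U]) auto
  then show ?case by simp
next
  case (insert s S)
  have "divdiff (\<lambda>z. c s * f s z + (\<Sum>s\<in>S. c s * f s z)) x m n
      = divdiff (\<lambda>z. c s * f s z) x m n + divdiff (\<lambda>z. \<Sum>s\<in>S. c s * f s z) x m n"
    using insert.prems assms(2,4) by (intro divdiff_add[of U] holomorphic_intros) auto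
  also have "divdiff (\<lambda>z. c s * f s z) x m n = c s * divdiff (f s) x m n"
    using insert.prems assms(2,4) by (intro divdiff_cmult[of U]) auto
  finally show ?case using insert by simp
qed

text \<open>Off the poles every summand is holomorphic, so the difference splits; the polynomial
  part, of degree at most \<open>d < n\<close>, is annihilated.\<close>

lemma divdiff_rational:
  assumes x: "equal_points_consecutive x N" and m: "1 \<le> m" "m + n \<le> N" and dn: "d < n"
    and S: "finite S" and off: "\<And>i. 1 \<le> i \<Longrightarrow> i \<le> N \<Longrightarrow> x i \<notin> zs ` S"
    and f: "\<And>z. z \<notin> zs ` S \<Longrightarrow> f z = (\<Sum>s\<in>S. b s * (1 / (z - zs s))) + (\<Sum>l\<le>d. a l * z ^ l)"
  shows "divdiff f x m n = (\<Sum>s\<in>S. - b s / psi x m (m + n) (zs s))"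
proof -
  define U where "U = - (zs ` S)"
  have U: "open U" using S by (auto simp: U_def intro: finite_imp_closed)
  have xU: "x i \<in> U" if "m \<le> i" "i \<le> m + n" for i
    using off[of i] that m by (auto simp: U_def)
  have hol: "(\<lambda>z. 1 / (z - zs s)) holomorphic_on U" if "s \<in> S" for s
    using that by (auto intro!: holomorphic_intros simp: U_def)
  have "divdiff f x m n = divdiff (\<lambda>z. (\<Sum>s\<in>S. b s * (1 / (z - zs s))) + (\<Sum>l\<le>d. a l * z ^ l)) x m n"
    using U f xU by (intro divdiff_cong[of U]) (auto simp: U_def)
  also have "\<dots> = divdiff (\<lambda>z. \<Sum>s\<in>S. b s * (1 / (z - zs s))) x m n + divdiff (\<lambda>z. \<Sum>l\<le>d. a l * z ^ l) x m n"
    using U xU by (intro divdiff_add[of U] holomorphic_intros) (auto simp: U_def)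
  also have "divdiff (\<lambda>z. \<Sum>s\<in>S. b s * (1 / (z - zs s))) x m n = (\<Sum>s\<in>S. b s * divdiff (\<lambda>z. 1 / (z - zs s)) x m n)"
    using U xU hol S by (intro divdiff_sum[of _ U]) auto
  also have "\<dots> = (\<Sum>s\<in>S. - b s / psi x m (m + n) (zs s))"
  proof (rule sum.cong[OF refl])
    fix s assume "s \<in> S"
    then have "divdiff (\<lambda>z. 1 / (z - zs s)) x m n = - 1 / psi x m (m + n) (zs s)"
      using off by (intro divdiff_pole[OF x m]) auto
    then show "b s * divdiff (\<lambda>z. 1 / (z - zs s)) x m n = - b s / psi x m (m + n) (zs s)"
      by simp
  qed
  also have "divdiff (\<lambda>z. \<Sum>l\<le>d. a l * z ^ l) x m n = (\<Sum>l\<le>d. a l * divdiff (\<lambda>z. z ^ l) x m n)"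
    by (rule divdiff_sum[of _ UNIV]) (auto intro!: holomorphic_intros)
  also have "\<dots> = 0"
    using divdiff_power_eq_0[OF x m] dn by (intro sum.neutral) auto
  finally show ?thesis by simp
qed

section \<open>The entries of the linear system as sums over the poles\<close>

lemma inner_product_sum:
  assumes "inner_product ip"
  shows "ip q (\<Sum>s\<in>S. c s *s v s) = (\<Sum>s\<in>S. c s * ip q (v s))"
proof -
  have add: "ip q (y + z) = ip q y + ip q z" and scale: "ip q (b *s y) = b * ip q y" for b y z
    using assms unfolding inner_product_def by blast+
  have "ip q 0 = 0" using scale[of 0 0] by simp
  then show ?thesis
    by (induction S rule: infinite_finite_induct) (simp_all add: add scale)
qed

text \<open>Extending \<open>psi x (j + 1) (p + i)\<close> to the full product over
  \<open>p + k\<close> nodes separates the row index, in \<open>alpha\<close>, from the column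
  index, in \<open>psi x 1 j\<close>, as the multilinear expansion requires. The order of the
  difference is at least \<open>p - k\<close>, hence exceeds \<open>d\<close>.\<close>

lemma itea_u_rational:
  assumes ip: "inner_product ip" and x: "equal_points_consecutive x (p + k)"
    and i: "i \<in> {1..k}" and j: "j \<le> k" and p: "d + k < p"
    and off: "\<And>i. 1 \<le> i \<Longrightarrow> i \<le> p + k \<Longrightarrow> x i \<notin> zs ` {1..\<mu>}"
    and F: "\<forall>z. z \<notin> zs ` {1..\<mu>} \<longrightarrow>
          F z = (\<Sum>s=1..\<mu>. (1 / (z - zs s)) *s v s) + (\<Sum>l\<le>d. z ^ l *s a l)"
  shows "itea_u ip q F x p i j
    = (\<Sum>s=1..\<mu>. - alpha ip q v zs x p k i s / psi x 1 (p + k) (zs s) * psi x 1 j (zs s))"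
proof -
  have "vec_divdiff F x (j + 1) (p + i) = (\<Sum>s=1..\<mu>. (- 1 / psi x (j + 1) (p + i) (zs s)) *s v s)"
  proof (rule iffD2[OF Finite_Cartesian_Product.vec_eq_iff], rule allI)
    fix l
    have "F z $ l = (\<Sum>s=1..\<mu>. (v s $ l) * (1 / (z - zs s))) + (\<Sum>l'\<le>d. (a l' $ l) * z ^ l')" if "z \<notin> zs ` {1..\<mu>}" for z
      using F that by (simp add: sum_component mult.commute)
    then have "divdiff (\<lambda>z. F z $ l) x (j + 1) (p + i - (j + 1))
        = (\<Sum>s=1..\<mu>. - (v s $ l) / psi x (j + 1) (j + 1 + (p + i - (j + 1))) (zs s))"
      using i j p off by (intro divdiff_rational[OF x]) auto
    then show "vec_divdiff F x (j + 1) (p + i) $ l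
        = (\<Sum>s=1..\<mu>. (- 1 / psi x (j + 1) (p + i) (zs s)) *s v s) $ l"
      using i j p by (simp add: vec_divdiff_def sum_component)
  qed
  then have "itea_u ip q F x p i j = (\<Sum>s=1..\<mu>. - 1 / psi x (j + 1) (p + i) (zs s) * ip q (v s))"
    by (simp only: itea_u_def inner_product_sum[OF ip])
  also have "\<dots> = (\<Sum>s=1..\<mu>. - alpha ip q v zs x p k i s / psi x 1 (p + k) (zs s) * psi x 1 j (zs s))"
  proof (rule sum.cong[OF refl])
    fix s assume "s \<in> {1..\<mu>}"
    then have "x i \<noteq> zs s" if "1 \<le> i" "i \<le> p + k" for i
      using off[OF that] by auto
    note nz = psi_nonzero[OF this]
    have "psi x 1 (p + k) (zs s) = psi x 1 j (zs s) * psi x (j + 1) (p + k) (zs s)"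
      unfolding psi_def using prod.ub_add_nat[of 1 j "\<lambda>r. zs s - x r" "p + k - j"] j p by simp
    also have "psi x (j + 1) (p + k) (zs s) = psi x (j + 1) (p + i) (zs s) * psi x (p + i + 1) (p + k) (zs s)"
      unfolding psi_def using i j p prod.ub_add_nat[of "j + 1" "p + i" "\<lambda>r. zs s - x r" "k - i"] by auto
    finally show "- 1 / psi x (j + 1) (p + i) (zs s) * ip q (v s)
      = - alpha ip q v zs x p k i s / psi x 1 (p + k) (zs s) * psi x 1 j (zs s)"
      using nz[where a = 1 and b = j] nz[where a = "p + i + 1" and b = "p + k"] nz[where a = "j + 1" and b = "p + i"] i j p
      by (simp add: alpha_def field_simps)
  qed
  finally show ?thesis .
qed

subsection \<open>The dominant term\<close>

text \<open>Common factors cancel, and at least one quotient \<open>H / L \<le> 1\<close> remains.\<close>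

lemma prod_ratio_le:
  fixes P :: "nat \<Rightarrow> real"
  assumes inj: "inj_on f {0..<n}" and i: "i < n" "n \<le> f i"
    and pos: "\<And>s. s \<in> {0..<n} \<union> f ` {0..<n} \<Longrightarrow> 0 < P s"
    and H: "\<And>i. i < n \<Longrightarrow> P i \<le> H"
    and L: "\<And>s. s \<in> f ` {0..<n} \<Longrightarrow> n \<le> s \<Longrightarrow> L \<le> P s"
    and "0 < L" "H \<le> L"
  shows "(\<Prod>i<n. P i) / (\<Prod>i<n. P (f i)) \<le> H / L"
proof -
  define I J where "I = {0..<n}" and "J = f ` {0..<n}"
  have fin [simp]: "finite I" "finite J" by (simp_all add: I_def J_def)
  have "card I = card J" using card_image[OF inj] by (simp add: I_def J_def)
  \<comment> \<open>As many poles enter as leave, and \<open>f i\<close> shows that at least one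
    enters.\<close>
  have "card (I - J) = card (J - I)"
    using \<open>card I = card J\<close> card_Diff_subset_Int[of I J] card_Diff_subset_Int[of J I]
    by (simp add: Int_commute)
  moreover have "f i \<in> J - I" using i by (auto simp: I_def J_def)
  then have "J - I \<noteq> {}" by blast
  then have "card (J - I) \<noteq> 0" by simp
  ultimately obtain m where m: "card (I - J) = Suc m" "card (J - I) = Suc m"
    by (metis not0_implies_Suc)
  have H0: "0 \<le> H" using pos[of i] H[of i] i by fastforce
  have "(\<Prod>i<n. P (f i)) = prod P J"
    using prod.reindex[OF inj, of P] by (simp add: J_def atLeast0LessThan)
  moreover have "(\<Prod>i<n. P i) = prod P I" by (simp add: I_def atLeast0LessThan)
  moreover have "prod P I = prod P (I \<inter> J) * prod P (I - J)" "prod P J = prod P (I \<inter> J) * prod P (J - I)"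
    using prod.Int_Diff[of I P J] prod.Int_Diff[of J P I] by (simp_all add: Int_commute)
  moreover have "prod P (I \<inter> J) > 0" using pos by (intro prod_pos) (auto simp: I_def)
  then have "prod P (I \<inter> J) \<noteq> 0" by (rule less_imp_neq[symmetric])
  ultimately have "(\<Prod>i<n. P i) / (\<Prod>i<n. P (f i)) = prod P (I - J) / prod P (J - I)"
    by (simp only: mult_divide_mult_cancel_left_if if_False)
  also have "\<dots> \<le> H ^ Suc m / L ^ Suc m"
  proof (rule frac_le)
    have "prod P (I - J) \<le> (\<Prod>s\<in>I - J. H)"
      using pos H by (intro prod_mono) (auto simp: I_def less_imp_le)
    then show "prod P (I - J) \<le> H ^ Suc m" using m(1) by simp
    have "(\<Prod>s\<in>J - I. L) \<le> prod P (J - I)"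
      using L \<open>0 < L\<close> by (intro prod_mono) (auto simp: I_def J_def)
    then show "L ^ Suc m \<le> prod P (J - I)" using m(2) by simp
  qed (use H0 \<open>0 < L\<close> in auto)
  also have "\<dots> = (H / L) ^ Suc m" by (simp add: power_divide)
  also have "\<dots> \<le> H / L"
    using H0 \<open>0 < L\<close> \<open>H \<le> L\<close> mult_left_mono[OF power_le_one[of "H / L" m], of "H / L"] by simp
  finally show ?thesis .
qed

text \<open>A bound free of \<open>p\<close> for the sum of all error terms: \<open>B\<close> bounds
  the entries and \<open>W\<close> the weights. The main choices are included as well, which only
  enlarges it.\<close>

definition det_bound :: "nat \<Rightarrow> nat \<Rightarrow> (nat \<Rightarrow> complex) \<Rightarrow> real \<Rightarrow> real \<Rightarrow> real" where
  "det_bound k \<mu> y B W =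
     (\<Sum>f\<in>PiE {0..<k} (\<lambda>_. {0..<\<mu>}). B ^ k * W ^ k * norm (\<Prod>j<k. \<Prod>i<j. y (f j) - y (f i)))"

text \<open>The weights \<open>w\<close> let one estimate serve both determinants: they are
  \<open>1\<close> for the system and \<open>zs s - z\<close> for \<open>Q\<close>. Multiplication
  by the product of the \<open>P i\<close> with \<open>i < k\<close> gives the main term size of
  order one.\<close>

lemma det_dominant_term:
  fixes e :: "nat \<Rightarrow> nat \<Rightarrow> complex" and P w y :: "nat \<Rightarrow> complex"
  assumes k: "0 < k" "k \<le> \<mu>" and P: "\<And>s. s < \<mu> \<Longrightarrow> P s \<noteq> 0"
    and H: "\<And>i. i < k \<Longrightarrow> norm (P i) \<le> H"
    and L: "\<And>s. k \<le> s \<Longrightarrow> s < \<mu> \<Longrightarrow> L \<le> norm (P s)" "0 < L" "H \<le> L"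
    and B: "\<And>i s. i < k \<Longrightarrow> s < \<mu> \<Longrightarrow> norm (e i s) \<le> B"
    and W: "\<And>s. s < \<mu> \<Longrightarrow> norm (w s) \<le> W"
  shows "norm ((\<Prod>i<k. P i) * Determinant.det (Matrix.mat k k (\<lambda>(i, j). \<Sum>s\<in>{0..<\<mu>}. e i s / P s * (w s * psi x 1 j (y s))))
      - Determinant.det (Matrix.mat k k (\<lambda>(i, j). e i j)) * ((\<Prod>i<k. w i) * (\<Prod>j<k. \<Prod>i<j. y j - y i)))
    \<le> det_bound k \<mu> y B W * (H / L)"
    (is "norm (?A * ?D - ?M) \<le> _")
proof -
  let ?F = "PiE {0..<k} (\<lambda>_. {0..<\<mu>})"
  let ?g = "\<lambda>f. B ^ k * W ^ k * norm (\<Prod>j<k. \<Prod>i<j. y (f j) - y (f i))"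
  let ?G = "PiE {0..<k} (\<lambda>_. {0..<k})"
  let ?t = "\<lambda>f. (\<Prod>i<k. e i (f i) / P (f i)) * ((\<Prod>i<k. w (f i)) * (\<Prod>j<k. \<Prod>i<j. y (f j) - y (f i)))"
  have A: "?A \<noteq> 0" using P k by auto
  have det_b: "Determinant.det (Matrix.mat k k (\<lambda>(i, j). w (f i) * psi x 1 j (y (f i))))
      = (\<Prod>i<k. w (f i)) * (\<Prod>j<k. \<Prod>i<j. y (f j) - y (f i))" for f
    by (simp only: det_row_factor[of k "\<lambda>i. w (f i)"] det_psi[of k x "\<lambda>i. y (f i)"])
  have "?D = Determinant.det (Matrix.mat k k (\<lambda>(i, j). e i j / P j)) *
       Determinant.det (Matrix.mat k k (\<lambda>(i, j). w i * psi x 1 j (y i))) +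
    (\<Sum>f\<in>?F - ?G. (\<Prod>i<k. e i (f i) / P (f i)) * Determinant.det (Matrix.mat k k (\<lambda>(i, j). w (f i) * psi x 1 j (y (f i)))))"
    using k by (intro det_sum_split) auto
  also have "\<dots> = Determinant.det (Matrix.mat k k (\<lambda>(i, j). e i j / P j)) * ((\<Prod>i<k. w i) * (\<Prod>j<k. \<Prod>i<j. y j - y i))
      + sum ?t (?F - ?G)"
    using det_b[of "\<lambda>i. i"] by (simp only: det_b)
  also have "Determinant.det (Matrix.mat k k (\<lambda>(i, j). e i j / P j)) = Determinant.det (Matrix.mat k k (\<lambda>(i, j). e i j)) * (\<Prod>i<k. 1 / P i)"
    using det_col_factor[of k e "\<lambda>j. 1 / P j"] by simp
  finally have "?A * ?D - ?M = ?A * (\<Prod>i<k. 1 / P i) * ?M - ?M + ?A * sum ?t (?F - ?G)"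
    by (simp add: algebra_simps)
  also have "?A * (\<Prod>i<k. 1 / P i) = 1"
    using P k by (simp flip: prod.distrib)
  finally have "norm (?A * ?D - ?M) = norm (\<Sum>f\<in>?F - ?G. ?A * ?t f)"
    by (simp add: sum_distrib_left)
  also have "\<dots> \<le> (\<Sum>f\<in>?F - ?G. ?g f * (H / L))"
  proof (rule sum_norm_le)
    fix f assume f: "f \<in> ?F - ?G"
    have f\<mu>: "f i < \<mu>" if "i < k" for i using f that by (auto simp: PiE_iff)
    \<comment> \<open>A choice outside \<open>?G\<close> picks, in some row, a pole of index at
      least \<open>k\<close>.\<close>
    obtain i0 where i0: "i0 < k" "k \<le> f i0" using f by (auto simp: PiE_iff not_less)
    define V where "V = (\<Prod>j<k. \<Prod>i<j. y (f j) - y (f i))"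
    show "norm (?A * ?t f) \<le> ?g f * (H / L)"
    proof (cases "inj_on f {0..<k}")
      case True
      have "(\<Prod>i<k. norm (P i)) / (\<Prod>i<k. norm (P (f i))) \<le> H / L"
        using True i0 f\<mu> P H L k by (intro prod_ratio_le[where P = "\<lambda>s. norm (P s)"]) auto
      moreover define E U Q where "E = (\<Prod>i<k. norm (e i (f i)))" and "U = (\<Prod>i<k. norm (w (f i)))"
        and "Q = (\<Prod>i<k. norm (P i)) / (\<Prod>i<k. norm (P (f i)))"
      moreover have "E \<le> B ^ k"
        using B f\<mu> prod_mono[of "{..<k}" "\<lambda>i. norm (e i (f i))" "\<lambda>_. B"] by (simp add: E_def)
      moreover have "U \<le> W ^ k"
        using W f\<mu> prod_mono[of "{..<k}" "\<lambda>i. norm (w (f i))" "\<lambda>_. W"] by (simp add: U_def)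
      moreover have nonneg: "0 \<le> E" "0 \<le> U" "0 \<le> Q" "0 \<le> norm V"
        by (auto simp: E_def U_def Q_def intro!: prod_nonneg divide_nonneg_nonneg)
      ultimately have "E * U * norm V * Q \<le> B ^ k * W ^ k * norm V * (H / L)"
        by (intro mult_mono order.refl mult_nonneg_nonneg) (auto intro: order.trans)
      moreover have "norm (?A * ?t f) = E * U * norm V * Q"
        by (simp only: V_def[symmetric] norm_mult norm_divide prod_norm[symmetric] prod_dividef E_def U_def Q_def)
           simp
      ultimately show ?thesis by (simp only: V_def)
    next
      case False
      then obtain i j where "i < j" "j < k" "f i = f j"
        unfolding inj_on_def by (metis atLeastLessThan_iff nat_neq_iff)
      then have "(\<Prod>i<j. y (f j) - y (f i)) = 0" by (intro prod_zero bexI[of _ i]) auto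
      with \<open>j < k\<close> have "V = 0" unfolding V_def by (intro prod_zero) auto
      then show ?thesis unfolding V_def[symmetric] by simp
    qed
  qed
  \<comment> \<open>Nonnegative terms are added to reach the full sum in
    \<open>det_bound\<close>.\<close>
  also have "\<dots> \<le> (\<Sum>f\<in>?F. ?g f * (H / L))"
  proof (rule sum_mono2)
    fix f assume "f \<in> ?F - (?F - ?G)"
    show "0 \<le> ?g f * (H / L)"
    proof -
      have "0 \<le> H" "0 \<le> B" "0 \<le> W"
        using H[of 0] B[of 0 0] W[of 0] k by (auto intro: order.trans[OF norm_ge_zero])
      then show ?thesis using L by (intro mult_nonneg_nonneg divide_nonneg_pos) auto
    qed
  qed (auto simp: finite_PiE)
  also have "\<dots> = sum ?g ?F * (H / L)"
    by (simp only: sum_distrib_right)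
  finally show ?thesis by (simp only: det_bound_def)
qed

section \<open>Auxiliary estimates: roots, poles, entry bounds and quotients\<close>

lemma powr_inverse_less_iff:
  assumes "0 < p" "0 \<le> x" "0 \<le> c"
  shows "x powr (1 / real p) < c \<longleftrightarrow> x < c ^ p" "c < x powr (1 / real p) \<longleftrightarrow> c ^ p < x"
proof -
  have "x powr (1 / real p) = root p x"
    using assms by (cases "x = 0") (auto simp: root_powr_inverse)
  moreover have "c = root p (c ^ p)" using assms by (simp add: real_root_power_cancel)
  ultimately show "x powr (1 / real p) < c \<longleftrightarrow> x < c ^ p" "c < x powr (1 / real p) \<longleftrightarrow> c ^ p < x"
    using assms(1) by (metis real_root_less_iff)+
qed

lemma eventually_less_power:
  fixes X :: "nat \<Rightarrow> real"
  assumes "(\<lambda>p. X p powr (1 / real p)) \<longlonglongrightarrow> l" "\<And>p. 0 \<le> X p" "l < c" "0 \<le> c"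
  shows "\<forall>\<^sub>F p in sequentially. X p < c ^ p"
  using order_tendstoD(2)[OF assms(1,3)] eventually_gt_at_top[of 0]
  by eventually_elim (use assms(2,4) powr_inverse_less_iff(1) in blast)

lemma eventually_power_less:
  fixes X :: "nat \<Rightarrow> real"
  assumes "(\<lambda>p. X p powr (1 / real p)) \<longlonglongrightarrow> l" "\<And>p. 0 \<le> X p" "c < l" "0 \<le> c"
  shows "\<forall>\<^sub>F p in sequentially. c ^ p < X p"
  using order_tendstoD(1)[OF assms(1,3)] eventually_gt_at_top[of 0]
  by eventually_elim (use assms(2,4) powr_inverse_less_iff(2) in blast)

text \<open>After multiplication by \<open>z - zs s0\<close> the limit at the pole would be
  \<open>0\<close> by continuity of \<open>f\<close>, but the partial fractions give
  \<open>b s0\<close>. The value of \<open>f\<close> at the pole itself does not enter the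
  limit.\<close>

lemma not_analytic_at_pole:
  fixes zs :: "nat \<Rightarrow> complex"
  assumes S: "finite S" "s0 \<in> S" "inj_on zs S" "b s0 \<noteq> 0" and h: "isCont h (zs s0)"
    and f: "\<And>z. z \<notin> zs ` S \<Longrightarrow> f z = (\<Sum>s\<in>S. b s * (1 / (z - zs s))) + h z"
  shows "\<not> f analytic_on {zs s0}"
proof
  assume "f analytic_on {zs s0}"
  define c where "c = zs s0"
  have "isCont f c" using \<open>f analytic_on {zs s0}\<close> analytic_at_imp_isCont by (auto simp: c_def)
  then have "f \<midarrow>c\<rightarrow> f c" by (simp add: isCont_def)
  then have lim1: "(\<lambda>z. (z - c) * f z) \<midarrow>c\<rightarrow> (c - c) * f c"
    by (intro tendsto_intros)
  have ne: "c \<noteq> zs s" if "s \<in> S - {s0}" for s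
    using S that by (auto simp: c_def inj_on_def)
  have "(\<lambda>z. b s0 + (z - c) * ((\<Sum>s\<in>S - {s0}. b s * (1 / (z - zs s))) + h z)) \<midarrow>c\<rightarrow>
      b s0 + (c - c) * ((\<Sum>s\<in>S - {s0}. b s * (1 / (c - zs s))) + h c)"
    using h ne by (intro tendsto_intros) (auto simp: isCont_def c_def)
  moreover have "\<forall>\<^sub>F z in at c. (z - c) * f z = b s0 + (z - c) * ((\<Sum>s\<in>S - {s0}. b s * (1 / (z - zs s))) + h z)"
  proof -
    have "open (- (zs ` (S - {s0})))" using S by (intro open_Compl finite_imp_closed) auto
    moreover have "c \<in> - (zs ` (S - {s0}))" using ne by auto
    ultimately have "\<forall>\<^sub>F z in at c. z \<in> - (zs ` (S - {s0}))"
      using eventually_at_topological by blast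
    moreover have "\<forall>\<^sub>F z in at c. z \<noteq> c" by (simp add: eventually_at_filter)
    ultimately show ?thesis
    proof eventually_elim
      case (elim z)
      then have "z \<notin> zs ` S" by (auto simp: c_def)
      then have "f z = b s0 * (1 / (z - c)) + (\<Sum>s\<in>S - {s0}. b s * (1 / (z - zs s))) + h z"
        using S by (simp add: f sum.remove[of S s0] c_def)
      moreover have "(z - c) * (b s0 * (1 / (z - c))) = b s0" using elim by simp
      ultimately show ?case by (simp only: distrib_left add.assoc)
    qed
  qed
  ultimately have "(\<lambda>z. (z - c) * f z) \<midarrow>c\<rightarrow> b s0"
    by (simp add: tendsto_cong)
  with lim1 have "b s0 = 0" using tendsto_unique[OF at_neq_bot] by fastforce
  with S show False by simp
qed

lemma norm_psi_le:
  assumes "\<And>i. a \<le> i \<Longrightarrow> i \<le> b \<Longrightarrow> norm (x i) \<le> R"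
  shows "norm (psi x a b z) \<le> (norm z + R) ^ (Suc b - a)"
proof -
  have "norm (psi x a b z) = (\<Prod>r=a..b. norm (z - x r))" by (simp add: psi_def prod_norm)
  also have "\<dots> \<le> (\<Prod>r=a..b. norm z + R)"
    using assms by (intro prod_mono) (auto intro!: order.trans[OF norm_triangle_ineq4] add_left_mono)
  finally show ?thesis by simp
qed

text \<open>The product in \<open>alpha\<close> has at most \<open>k\<close> factors, however large
  \<open>p\<close> is, so bounded nodes give a bound free of \<open>p\<close>.\<close>

lemma norm_alpha_le:
  assumes x: "\<And>i. 1 \<le> i \<Longrightarrow> i \<le> p + k \<Longrightarrow> norm (x i) \<le> R" and s: "s \<in> {1..\<mu>}" and "0 \<le> R" "1 \<le> i"
  shows "norm (alpha ip q v zs x p k i s)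
    \<le> (\<Sum>s=1..\<mu>. norm (ip q (v s))) * (1 + R + (\<Sum>s=1..\<mu>. norm (zs s))) ^ k"
proof -
  have mem: "norm (g s) \<le> (\<Sum>s=1..\<mu>. norm (g s))" for g :: "nat \<Rightarrow> complex"
    using s by (intro member_le_sum) auto
  have "norm (psi x (p + i + 1) (p + k) (zs s)) \<le> (norm (zs s) + R) ^ (Suc (p + k) - (p + i + 1))"
    using x by (intro norm_psi_le) auto
  also have "\<dots> \<le> (1 + R + (\<Sum>s=1..\<mu>. norm (zs s))) ^ (Suc (p + k) - (p + i + 1))"
    using mem[of zs] \<open>0 \<le> R\<close> by (intro power_mono) auto
  \<comment> \<open>The summand \<open>1\<close> makes the base at least \<open>1\<close>, so the
    exponent may be raised to \<open>k\<close>.\<close>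
  also have "\<dots> \<le> (1 + R + (\<Sum>s=1..\<mu>. norm (zs s))) ^ k"
    using \<open>0 \<le> R\<close> by (intro power_increasing) (auto intro!: sum_nonneg add_increasing2)
  finally show ?thesis
    unfolding alpha_def norm_mult using mem[of "\<lambda>s. ip q (v s)"] by (intro mult_mono) (auto intro!: sum_nonneg)
qed

text \<open>Both claims are instances of \<open>det_dominant_term\<close>, with poles renumbered
  from \<open>0\<close>. The minus sign of the pole expansion goes into the coefficients
  \<open>e\<close> and produces \<open>(-1) ^ k\<close>.\<close>

lemma itea_det_estimates:
  fixes v :: "nat \<Rightarrow> complex ^ 'n" and q :: "complex ^ 'n"
  assumes ip: "inner_product ip" and x: "equal_points_consecutive x (p + k)"
    and k: "0 < k" "k \<le> \<mu>" and p: "d + k < p"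
    and off: "\<And>i. 1 \<le> i \<Longrightarrow> i \<le> p + k \<Longrightarrow> x i \<notin> zs ` {1..\<mu>}"
    and F: "\<forall>z. z \<notin> zs ` {1..\<mu>} \<longrightarrow>
          F z = (\<Sum>s=1..\<mu>. (1 / (z - zs s)) *s v s) + (\<Sum>l\<le>d. z ^ l *s a l)"
    and R: "\<And>i. 1 \<le> i \<Longrightarrow> i \<le> p + k \<Longrightarrow> norm (x i) \<le> R" "0 \<le> R"
    and H: "\<And>i. 1 \<le> i \<Longrightarrow> i \<le> k \<Longrightarrow> norm (psi x 1 (p + k) (zs i)) \<le> H"
    and L: "\<And>s. k < s \<Longrightarrow> s \<le> \<mu> \<Longrightarrow> L \<le> norm (psi x 1 (p + k) (zs s))" "0 < L" "H \<le> L"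
  defines "A \<equiv> (\<Prod>i=1..k. psi x 1 (p + k) (zs i))"
    and "V \<equiv> (\<Prod>j<k. \<Prod>i<j. zs (Suc j) - zs (Suc i))"
    and "T \<equiv> T_det ip q v zs x p k (\<lambda>j. j)"
    and "C \<equiv> det_bound k \<mu> (\<lambda>s. zs (Suc s))
      ((\<Sum>s=1..\<mu>. norm (ip q (v s))) * (1 + R + (\<Sum>s=1..\<mu>. norm (zs s))) ^ k)"
    and "u \<equiv> itea_u ip q F x p"
  shows "norm (A * Determinant.det (itea_system u k) - (-1) ^ k * T * V) \<le> C 1 * (H / L)"
    and "(\<And>s. s \<in> {1..\<mu>} \<Longrightarrow> norm (zs s - z) \<le> W) \<Longrightarrow>
      norm (A * itea_Q u x k z - (-1) ^ k * T * V * (\<Prod>i<k. zs (Suc i) - z)) \<le> C W * (H / L)"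
proof -
  define e where "e = (\<lambda>i s. - alpha ip q v zs x p k (Suc i) (Suc s))"
  define P where "P = (\<lambda>s. psi x 1 (p + k) (zs (Suc s)))"
  have A: "A = (\<Prod>i<k. P i)"
    unfolding A_def P_def by (simp add: prod.atLeast1_atMost_eq)
  have det_e: "Determinant.det (Matrix.mat k k (\<lambda>(i, j). e i j)) = (-1) ^ k * T"
    using det_row_factor[of k "\<lambda>_. - 1" "\<lambda>i j. alpha ip q v zs x p k (i + 1) (j + 1)"]
    by (simp add: e_def T_def T_det_def)
  have u: "u (Suc i) j = (\<Sum>s\<in>{0..<\<mu>}. e i s / P s * psi x 1 j (zs (Suc s)))" if "i < k" "j \<le> k" for i j
    unfolding u_def using that
    by (subst itea_u_rational[OF ip x _ _ p off F])
       (auto simp: e_def P_def sum.atLeast1_atMost_eq atLeast0LessThan)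
  have est: "norm ((\<Prod>i<k. P i) * Determinant.det (Matrix.mat k k (\<lambda>(i, j). \<Sum>s\<in>{0..<\<mu>}. e i s / P s * (w s * psi x 1 j (zs (Suc s)))))
      - Determinant.det (Matrix.mat k k (\<lambda>(i, j). e i j)) * ((\<Prod>i<k. w i) * V)) \<le> C W * (H / L)"
    if W: "\<And>s. s < \<mu> \<Longrightarrow> norm (w s) \<le> W" for w W
    unfolding C_def V_def
  proof (rule det_dominant_term[OF k _ _ _ L(2,3) _ W])
    show "P s \<noteq> 0" if "s < \<mu>" for s
    proof -
      have "x i \<noteq> zs (Suc s)" if "1 \<le> i" "i \<le> p + k" for i
        using off[OF that] \<open>s < \<mu>\<close> by auto
      then show ?thesis unfolding P_def by (rule psi_nonzero) auto
    qed
    show "norm (P i) \<le> H" if "i < k" for i using H[of "Suc i"] that by (simp add: P_def)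
    show "L \<le> norm (P s)" if "k \<le> s" "s < \<mu>" for s using L(1)[of "Suc s"] that by (simp add: P_def)
    show "norm (e i s) \<le> (\<Sum>s=1..\<mu>. norm (ip q (v s))) * (1 + R + (\<Sum>s=1..\<mu>. norm (zs s))) ^ k"
      if "i < k" "s < \<mu>" for i s
      unfolding e_def norm_minus_cancel using that R by (intro norm_alpha_le) auto
  qed
  have "itea_system u k = Matrix.mat k k (\<lambda>(i, j). \<Sum>s\<in>{0..<\<mu>}. e i s / P s * (1 * psi x 1 j (zs (Suc s))))"
    by (rule eq_matI) (auto simp: itea_system_def u)
  then show "norm (A * Determinant.det (itea_system u k) - (-1) ^ k * T * V) \<le> C 1 * (H / L)"
    using est[of "\<lambda>_. 1" 1] by (simp only: A det_e) simp
  assume W: "\<And>s. s \<in> {1..\<mu>} \<Longrightarrow> norm (zs s - z) \<le> W"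
  \<comment> \<open>The node \<open>x (j + 1)\<close> cancels:
    \<open>(zs s - x (j + 1)) - (z - x (j + 1)) = zs s - z\<close>.\<close>
  have mat: "Matrix.mat k k (\<lambda>(i, j). u (i + 1) (j + 1) - (z - x (j + 1)) * u (i + 1) j)
      = Matrix.mat k k (\<lambda>(i, j). \<Sum>s\<in>{0..<\<mu>}. e i s / P s * ((zs (Suc s) - z) * psi x 1 j (zs (Suc s))))"
  proof (rule cong_mat[OF refl refl], unfold split_conv)
    fix i j assume ij: "i < k" "j < k"
    have "u (i + 1) (j + 1) - (z - x (j + 1)) * u (i + 1) j
      = (\<Sum>s\<in>{0..<\<mu>}. e i s / P s * psi x 1 (Suc j) (zs (Suc s)) - (z - x (j + 1)) * (e i s / P s * psi x 1 j (zs (Suc s))))"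
      using ij u[of i "Suc j"] u[of i j] by (simp add: sum_subtractf sum_distrib_left)
    also have "\<dots> = (\<Sum>s\<in>{0..<\<mu>}. e i s / P s * ((zs (Suc s) - z) * psi x 1 j (zs (Suc s))))"
      unfolding psi_Suc by (intro sum.cong refl) (simp add: algebra_simps diff_divide_distrib)
    finally show "u (i + 1) (j + 1) - (z - x (j + 1)) * u (i + 1) j
      = (\<Sum>s\<in>{0..<\<mu>}. e i s / P s * ((zs (Suc s) - z) * psi x 1 j (zs (Suc s))))" .
  qed
  show "norm (A * itea_Q u x k z - (-1) ^ k * T * V * (\<Prod>i<k. zs (Suc i) - z)) \<le> C W * (H / L)"
  proof -
    have "(-1) ^ k * T * V * w = (-1) ^ k * T * (w * V)" for w by (simp only: mult_ac)
    moreover have "norm (zs (Suc s) - z) \<le> W" if "s < \<mu>" for s using W[of "Suc s"] that by simp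
    ultimately show ?thesis
      using est[of "\<lambda>s. zs (Suc s) - z" W] mat by (simp only: itea_Q_eq_det A det_e)
  qed
qed

text \<open>The common factor \<open>a\<close> cancels in \<open>Q / D\<close>. Smallness of
  \<open>c * \<delta>\<close> keeps \<open>a * D\<close> at modulus at least
  \<open>norm t / 2\<close>, so the two additive errors can be divided out.\<close>

lemma quotient_estimate:
  fixes a D Q t w :: complex
  assumes D: "norm (a * D - t) \<le> c * \<delta>" and Q: "norm (a * Q - t * w) \<le> c' * \<delta>" and w: "norm w \<le> m"
    and small: "c * \<delta> \<le> norm t / 2" and "t \<noteq> 0" "0 \<le> \<delta>" "0 \<le> c"
  shows "D \<noteq> 0" and "norm (Q / D - w) \<le> 2 * (c' + m * c) / norm t * \<delta>"
proof -
  have "norm t - norm (a * D) \<le> norm (a * D - t)"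
    by (metis norm_minus_commute norm_triangle_ineq2)
  then have aD: "norm t / 2 \<le> norm (a * D)" using D small by linarith
  then have "a * D \<noteq> 0" using \<open>t \<noteq> 0\<close> by auto
  then show "D \<noteq> 0" by simp
  have "a * Q - w * (a * D) = (a * Q - t * w) - w * (a * D - t)"
    by (simp add: algebra_simps)
  then have "norm (a * Q - w * (a * D)) \<le> norm (a * Q - t * w) + norm (w * (a * D - t))"
    by (metis norm_triangle_ineq4)
  also have "norm (w * (a * D - t)) \<le> m * (c * \<delta>)"
    unfolding norm_mult using w D norm_ge_zero[of w] by (intro mult_mono norm_ge_zero) linarith+
  finally have num: "norm (a * Q - w * (a * D)) \<le> (c' + m * c) * \<delta>"
    using Q by (simp add: algebra_simps)
  have "Q / D - w = (a * Q - w * (a * D)) / (a * D)"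
    using \<open>a * D \<noteq> 0\<close> by (simp add: field_simps)
  then have "norm (Q / D - w) = norm (a * Q - w * (a * D)) / norm (a * D)"
    by (simp only: norm_divide)
  also have "\<dots> \<le> (c' + m * c) * \<delta> / (norm t / 2)"
    by (rule frac_le[OF order.trans[OF norm_ge_zero num] num _ aD]) (use \<open>t \<noteq> 0\<close> in simp)
  finally show "norm (Q / D - w) \<le> 2 * (c' + m * c) / norm t * \<delta>"
    by (simp add: mult_ac)
qed

lemma vandermonde_insert:
  "vandermonde k (\<lambda>i. if i = 0 then z else zs i)
   = (\<Prod>j<k. \<Prod>i<j. zs (Suc j) - zs (Suc i)) * (\<Prod>i<k. zs (Suc i) - z)"
  unfolding vandermonde_def lessThan_Suc_atMost[symmetric]
  by (simp add: prod.lessThan_Suc_shift prod.distrib mult.commute del: prod.lessThan_Suc)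

text \<open>The constant \<open>C\<close> disappears in the limit because a slightly larger base
  absorbs it.\<close>

lemma limsup_powr_le:
  fixes X \<delta> :: "nat \<Rightarrow> real"
  assumes X: "\<forall>\<^sub>F p in sequentially. X p \<le> C * \<delta> p" "\<And>p. 0 \<le> X p" "0 \<le> C"
    and \<delta>: "\<And>\<rho>'. \<rho> < \<rho>' \<Longrightarrow> \<forall>\<^sub>F p in sequentially. \<delta> p \<le> \<rho>' ^ p" and \<rho>: "0 < \<rho>"
  shows "limsup (\<lambda>p. ereal (X p powr (1 / real p))) \<le> ereal \<rho>"
proof -
  have "limsup (\<lambda>p. ereal (X p powr (1 / real p))) \<le> ereal \<rho> + ereal \<epsilon>" if "0 < \<epsilon>" for \<epsilon>
  proof -
    \<comment> \<open>\<open>\<rho>1\<close> is a rate for \<open>\<delta>\<close>; the margin up to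
      \<open>\<rho>2\<close> swallows \<open>C\<close>, since \<open>(\<rho>2 / \<rho>1) ^ p\<close>
      is unbounded.\<close>
    define \<rho>1 \<rho>2 where "\<rho>1 = \<rho> + \<epsilon> / 2" and "\<rho>2 = \<rho> + \<epsilon>"
    have \<rho>12: "\<rho> < \<rho>1" "\<rho>1 < \<rho>2" "0 < \<rho>1" using \<rho> that by (auto simp: \<rho>1_def \<rho>2_def)
    have "filterlim (\<lambda>p. (\<rho>2 / \<rho>1) ^ p) at_top sequentially"
      using \<rho>12 by (intro filterlim_at_infinity_imp_filterlim_at_top filterlim_realpow_sequentially_gt1) auto
    then have "\<forall>\<^sub>F p in sequentially. C \<le> (\<rho>2 / \<rho>1) ^ p"
      by (auto simp: filterlim_at_top)
    then have "\<forall>\<^sub>F p in sequentially. ereal (X p powr (1 / real p)) \<le> ereal \<rho>2"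
      using X(1) \<delta>[OF \<rho>12(1)] eventually_gt_at_top[of 0]
    proof eventually_elim
      case (elim p)
      have "X p \<le> C * \<rho>1 ^ p"
        using elim(2) mult_left_mono[OF elim(3) \<open>0 \<le> C\<close>] by linarith
      also have "\<dots> \<le> (\<rho>2 / \<rho>1) ^ p * \<rho>1 ^ p"
        using elim(1) \<rho>12 by (intro mult_right_mono) auto
      also have "\<dots> = \<rho>2 ^ p" using \<rho>12 by (simp add: power_divide)
      finally have "\<not> \<rho>2 < X p powr (1 / real p)"
        using powr_inverse_less_iff(2)[of p "X p" \<rho>2] elim(4) X(2)[of p] \<rho>12 by simp
      then show ?case by simp
    qed
    then have "limsup (\<lambda>p. ereal (X p powr (1 / real p))) \<le> ereal \<rho>2" by (rule Limsup_bounded)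
    then show ?thesis by (simp add: \<rho>2_def)
  qed
  then show ?thesis by (blast intro: ereal_le_epsilon2)
qed

subsection \<open>Asymptotics of the interpolation points\<close>

lemma exists_row_bound:
  assumes "\<not> array_limit_point_infinity k \<xi>"
  obtains R where "0 \<le> R" "\<forall>\<^sub>F p in sequentially. \<forall>i\<in>{1..p + k}. norm (\<xi> p i) \<le> R"
proof -
  obtain R where R: "\<forall>\<^sub>F p in sequentially. \<forall>i\<in>{1..p + k}. norm (\<xi> p i) \<le> R"
    using assms unfolding array_limit_point_infinity_def by (auto simp: not_frequently not_less)
  have "\<forall>\<^sub>F p in sequentially. \<forall>i\<in>{1..p + k}. norm (\<xi> p i) \<le> max R 0"
    using R by eventually_elim auto
  then show ?thesis using that[of "max R 0"] by simp
qed

lemma eventually_not_in_row: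
  assumes "\<not> array_limit_point k \<xi> z"
  shows "\<forall>\<^sub>F p in sequentially. \<forall>i\<in>{1..p + k}. \<xi> p i \<noteq> z"
proof -
  obtain U where "z \<in> U" "\<forall>\<^sub>F p in sequentially. \<forall>i\<in>{1..p + k}. \<xi> p i \<notin> U"
    using assms unfolding array_limit_point_def by (auto simp: not_frequently)
  then show ?thesis by (elim eventually_mono) auto
qed

text \<open>Far away from the nodes all factors of \<open>\<Psi> p\<close> have modulus at least \<open>1\<close>, so the limit of the \<open>p\<close>-th
  roots is at least \<open>1\<close>. This spares any potential theory.\<close>

lemma limit_constant_pos:
  fixes E :: "complex set" and \<kappa> :: real
  assumes E: "compact E" and inf: "\<not> array_limit_point_infinity k \<xi>" and \<Phi>: "\<And>z. 0 < \<Phi> z"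
    and lim: "\<And>z. z \<notin> E \<Longrightarrow> (\<lambda>p. norm (psi (\<xi> p) 1 (p + k) z) powr (1 / real p)) \<longlonglongrightarrow> \<kappa> * \<Phi> z"
  shows "0 < \<kappa>"
proof -
  obtain R where R: "0 \<le> R" "\<forall>\<^sub>F p in sequentially. \<forall>i\<in>{1..p + k}. norm (\<xi> p i) \<le> R"
    using exists_row_bound[OF inf] .
  obtain b where b: "\<And>z. z \<in> E \<Longrightarrow> norm z \<le> b"
    using compact_imp_bounded[OF E] unfolding bounded_iff by blast
  \<comment> \<open>This point lies outside \<open>E\<close> and at distance at least
    \<open>1\<close> from every node of modulus at most \<open>R\<close>; \<open>b\<close> can be
    negative only if \<open>E\<close> is empty, hence the absolute value.\<close>
  define z0 :: complex where "z0 = of_real (R + \<bar>b\<bar> + 1)"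
  have norm_z0: "norm z0 = R + \<bar>b\<bar> + 1" using R unfolding z0_def norm_of_real by simp
  then have "z0 \<notin> E" using b[of z0] R by auto
  have "\<forall>\<^sub>F p in sequentially. 1 \<le> norm (psi (\<xi> p) 1 (p + k) z0) powr (1 / real p)"
    using R(2)
  proof eventually_elim
    case (elim p)
    have "1 \<le> norm (z0 - \<xi> p i)" if "i \<in> {1..p + k}" for i
    proof -
      have "norm (\<xi> p i) \<le> R" using elim that by blast
      then show ?thesis using norm_triangle_ineq2[of z0 "\<xi> p i"] norm_z0 by linarith
    qed
    then have "1 \<le> norm (psi (\<xi> p) 1 (p + k) z0)"
      unfolding psi_def prod_norm[symmetric] by (rule prod_ge_1)
    then show ?case by (intro ge_one_powr_ge_zero) auto
  qed
  then have "1 \<le> \<kappa> * \<Phi> z0"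
    by (rule tendsto_lowerbound[OF lim[OF \<open>z0 \<notin> E\<close>]]) simp
  then have "0 < \<kappa> * \<Phi> z0" by linarith
  then show "0 < \<kappa>" using \<Phi> by (rule zero_less_mult_pos2)
qed

text \<open>The uniform distance bounds the main term of \<open>Q\<close> from below, which turns an
  additive error into a relative one.\<close>

lemma compact_avoids_finite:
  fixes X :: "complex set"
  assumes "compact X" "finite S" "X \<subseteq> - S"
  obtains \<eta> where "0 < \<eta>" "\<And>z s. z \<in> X \<Longrightarrow> s \<in> S \<Longrightarrow> \<eta> \<le> norm (s - z)"
proof -
  obtain d where "d > 0" "\<forall>x\<in>X. \<forall>y\<in>S. d \<le> dist x y"
    using separate_compact_closed[OF assms(1) finite_imp_closed[OF assms(2)]] assms(3) by blast
  then show ?thesis using that[of d] by (auto simp: dist_norm norm_minus_commute)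
qed

text \<open>Uniform O-terms are expressed by a constant \<open>C\<close> chosen before
  \<open>p\<close> and \<open>z\<close>. Eventual nonsingularity of the system is asserted
  separately because it gives the denominator polynomial its meaning.\<close>

theorem theorem5p2:
  fixes E :: "complex set" and g :: "complex \<Rightarrow> real"
    and \<Phi> :: "complex \<Rightarrow> real" and \<kappa> :: real
    and \<xi> :: "nat \<Rightarrow> nat \<Rightarrow> complex"
    and \<Psi> :: "nat \<Rightarrow> complex \<Rightarrow> complex"
    and ip :: "complex ^ 'n \<Rightarrow> complex ^ 'n \<Rightarrow> complex" and q :: "complex ^ 'n"
    and F :: "complex \<Rightarrow> complex ^ 'n"
    and v :: "nat \<Rightarrow> complex ^ 'n" and zs :: "nat \<Rightarrow> complex"
    and a :: "nat \<Rightarrow> complex ^ 'n"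
    and u :: "nat \<Rightarrow> nat \<Rightarrow> nat \<Rightarrow> complex"
    and T :: "nat \<Rightarrow> complex"
    and \<delta> :: "nat \<Rightarrow> real"
    and k r \<mu> d :: nat
  assumes E: "compact E"
    and green: "greens_function E g"
    and Phi: "\<Phi> = (\<lambda>z. exp (g z))"
    and kappa: "\<kappa> = log_capacity E"
    and consecutive: "\<forall>p\<ge>1. equal_points_consecutive (\<xi> p) (p + k)"
    and no_limit_points: "\<forall>z\<in>- E. \<not> array_limit_point k \<xi> z"
    and no_limit_point_infinity: "\<not> array_limit_point_infinity k \<xi>"
    and Psi: "\<Psi> = (\<lambda>p. psi (\<xi> p) 1 (p + k))"
    and asymptotics: "\<forall>X. compact X \<and> X \<subseteq> - E \<longrightarrow>
          uniform_limit X (\<lambda>p z. norm (\<Psi> p z) powr (1 / real p)) (\<lambda>z. \<kappa> * \<Phi> z) sequentially"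
    and ip: "inner_product ip" and q: "q \<noteq> 0"
    and F: "\<forall>z. z \<notin> zs ` {1..\<mu>} \<longrightarrow>
          F z = (\<Sum>s=1..\<mu>. (1 / (z - zs s)) *s v s) + (\<Sum>l\<le>d. z ^ l *s a l)"
    and zs_distinct: "inj_on zs {1..\<mu>}"
    and v_nonzero: "\<forall>s\<in>{1..\<mu>}. v s \<noteq> 0"
    and F_analytic: "\<forall>l. (\<lambda>z. F z $ l) analytic_on E"
    and ordered: "\<forall>i j. 1 \<le> i \<and> i \<le> j \<and> j \<le> \<mu> \<longrightarrow> \<Phi> (zs i) \<le> \<Phi> (zs j)"
    and k: "1 \<le> k" "k < \<mu>"
    and r: "1 \<le> r" "k + r \<le> \<mu>"
    and gap_below: "\<Phi> (zs k) < \<Phi> (zs (k + 1))"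
    and level: "\<forall>j\<in>{1..r}. \<Phi> (zs (k + j)) = \<Phi> (zs (k + 1))"
    and gap_above: "k + r < \<mu> \<longrightarrow> \<Phi> (zs (k + r)) < \<Phi> (zs (k + r + 1))"
    and qv: "(\<Prod>i=1..k. ip q (v i)) \<noteq> 0"
    and u: "u = (\<lambda>p. itea_u ip q F (\<xi> p) p)"
    and T: "T = (\<lambda>p. T_det ip q v zs (\<xi> p) p k (\<lambda>j. j))"
    and delta: "\<delta> = (\<lambda>p. Psi_hat (\<Psi> p) \<Phi> zs k / Psi_tilde (\<Psi> p) zs k r)"
  shows "(\<forall>p\<ge>1. T p \<noteq> 0) \<and>
    (\<forall>X. compact X \<and> X \<subseteq> - (zs ` {1..k}) \<longrightarrow>
       (\<exists>C. \<forall>\<^sub>F p in sequentially. \<forall>z\<in>X. \<exists>\<epsilon>.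
          itea_Q (u p) (\<xi> p) k z =
            (-1) ^ k * T p * vandermonde k (\<lambda>i. if i = 0 then z else zs i)
              * inverse (\<Prod>i=1..k. \<Psi> p (zs i)) * (1 + \<epsilon>)
          \<and> norm \<epsilon> \<le> C * \<delta> p)) \<and>
    (\<forall>\<^sub>F p in sequentially. Determinant.det (itea_system (u p) k) \<noteq> 0) \<and>
    (\<forall>X. compact X \<longrightarrow>
       (\<exists>C. \<forall>\<^sub>F p in sequentially. \<forall>z\<in>X.
          norm (itea_denom (u p) (\<xi> p) k z - (\<Prod>i=1..k. z - zs i)) \<le> C * \<delta> p)) \<and>
    (\<forall>z. limsup (\<lambda>p. ereal (norm (itea_denom (u p) (\<xi> p) k z - (\<Prod>i=1..k. z - zs i))
                              powr (1 / real p)))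
          \<le> ereal (\<Phi> (zs k) / \<Phi> (zs (k + 1))))"
proof -
  have \<Phi>_pos: "0 < \<Phi> z" for z by (simp add: Phi)
  have lim: "(\<lambda>p. norm (\<Psi> p z) powr (1 / real p)) \<longlonglongrightarrow> \<kappa> * \<Phi> z" if "z \<notin> E" for z
    using asymptotics[rule_format, of "{z}"] that by (auto intro: tendsto_uniform_limitI)
  have \<kappa>: "0 < \<kappa>"
    by (rule limit_constant_pos[OF E no_limit_point_infinity \<Phi>_pos lim[unfolded Psi]])
  \<comment> \<open>Some component of \<open>v s\<close> is nonzero, so that component of
    \<open>F\<close> has a genuine pole there.\<close>
  have zs_E: "zs s \<notin> E" if s: "s \<in> {1..\<mu>}" for s
  proof
    assume "zs s \<in> E"
    obtain l where l: "v s $ l \<noteq> 0"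
      using v_nonzero s by (metis Finite_Cartesian_Product.vec_eq_iff zero_index)
    have "\<not> (\<lambda>z. F z $ l) analytic_on {zs s}"
    proof (rule not_analytic_at_pole[OF _ s zs_distinct])
      show "F z $ l = (\<Sum>s\<in>{1..\<mu>}. v s $ l * (1 / (z - zs s))) + (\<Sum>l'\<le>d. a l' $ l * z ^ l')"
        if "z \<notin> zs ` {1..\<mu>}" for z
        using F that by (simp add: sum_component mult.commute)
    qed (use l in \<open>auto intro!: continuous_intros\<close>)
    with F_analytic \<open>zs s \<in> E\<close> show False by (meson analytic_on_subset empty_subsetI insert_subset)
  qed
  \<comment> \<open>A constant strictly between the two limits of \<open>p\<close>-th roots
    separates the values themselves once raised to the power \<open>p\<close>.\<close>
  have growth: "\<forall>\<^sub>F p in sequentially. norm (\<Psi> p (zs s)) < norm (\<Psi> p (zs t))"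
    if st: "s \<in> {1..\<mu>}" "t \<in> {1..\<mu>}" "\<Phi> (zs s) < \<Phi> (zs t)" for s t
  proof -
    obtain c where c: "\<kappa> * \<Phi> (zs s) < c" "c < \<kappa> * \<Phi> (zs t)"
      using dense mult_strict_left_mono[OF st(3) \<kappa>] by blast
    have "0 \<le> c" using c(1) mult_pos_pos[OF \<kappa> \<Phi>_pos[of "zs s"]] by linarith
    show ?thesis
      using eventually_less_power[OF lim[OF zs_E[OF st(1)]] norm_ge_zero c(1) \<open>0 \<le> c\<close>]
        eventually_power_less[OF lim[OF zs_E[OF st(2)]] norm_ge_zero c(2) \<open>0 \<le> c\<close>]
      by eventually_elim linarith
  qed

  \<comment> \<open>Exponential decay of the error ratio\<close>
  define hat where "hat = (\<lambda>p. Psi_hat (\<Psi> p) \<Phi> zs k)"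
  define tilde where "tilde = (\<lambda>p. Psi_tilde (\<Psi> p) zs k r)"
  define \<rho> where "\<rho> = \<Phi> (zs k) / \<Phi> (zs (k + 1))"
  have \<rho>: "0 < \<rho>" "\<rho> < 1" using \<Phi>_pos gap_below by (auto simp: \<rho>_def)
  have \<delta>_eq: "\<delta> p = hat p / tilde p" for p by (simp add: delta hat_def tilde_def)
  have hat: "norm (\<Psi> p (zs i)) \<le> hat p" if "i \<in> {1..k}" "\<Phi> (zs i) = \<Phi> (zs k)" for p i
    unfolding hat_def Psi_hat_def using that by (intro Max_ge) auto
  have tilde: "tilde p \<le> norm (\<Psi> p (zs (k + j)))" if "j \<in> {1..r}" for p j
    unfolding tilde_def Psi_tilde_def using that by (intro Min_le) auto
  have hat_less: "hat p < c \<longleftrightarrow> (\<forall>i\<in>{1..k}. \<Phi> (zs i) = \<Phi> (zs k) \<longrightarrow> norm (\<Psi> p (zs i)) < c)" for p c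
    unfolding hat_def Psi_hat_def using k by (subst Max_less_iff) auto
  have less_tilde: "c < tilde p \<longleftrightarrow> (\<forall>j\<in>{1..r}. c < norm (\<Psi> p (zs (k + j))))" for p c
    unfolding tilde_def Psi_tilde_def using r by (subst Min_gr_iff) auto
  have hat_nonneg: "0 \<le> hat p" for p
    using order.trans[OF norm_ge_zero hat[of k p]] k by simp
  have \<delta>_power: "\<forall>\<^sub>F p in sequentially. 0 < tilde p \<and> \<delta> p \<le> \<rho>' ^ p" if "\<rho> < \<rho>'" for \<rho>'
  proof -
    \<comment> \<open>The slack between \<open>\<rho>\<close> and \<open>\<rho>'\<close> is shared
      equally: \<open>c1\<close> lies above the level of \<open>zs k\<close>, \<open>c2\<close>
      below that of \<open>zs (k + 1)\<close>, and \<open>c1 / c2 = \<rho>'\<close>.\<close>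
    define t where "t = sqrt (\<rho> / \<rho>')"
    have t: "0 < t" "t < 1" "t * t = \<rho> / \<rho>'" using \<rho> that by (auto simp: t_def)
    define c1 c2 where "c1 = \<kappa> * \<Phi> (zs k) / t" and "c2 = \<kappa> * \<Phi> (zs (k + 1)) * t"
    have c: "\<kappa> * \<Phi> (zs k) < c1" "0 < c1" "c2 < \<kappa> * \<Phi> (zs (k + 1))" "0 < c2"
      using t \<kappa> \<Phi>_pos by (simp_all add: c1_def c2_def field_simps)
    have "c1 / c2 = \<rho> / (t * t)"
      using \<kappa> t(1) by (simp add: c1_def c2_def \<rho>_def)
    also have "\<dots> = \<rho>'" using \<rho> that by (simp add: t(3))
    finally have c12: "c1 / c2 = \<rho>'" .
    have "\<forall>\<^sub>F p in sequentially. \<forall>i\<in>{1..k}. \<Phi> (zs i) = \<Phi> (zs k) \<longrightarrow> norm (\<Psi> p (zs i)) < c1 ^ p"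
    proof (rule eventually_ball_finite[OF finite_atLeastAtMost], rule ballI)
      fix i assume i: "i \<in> {1..k}"
      show "\<forall>\<^sub>F p in sequentially. \<Phi> (zs i) = \<Phi> (zs k) \<longrightarrow> norm (\<Psi> p (zs i)) < c1 ^ p"
      proof (cases "\<Phi> (zs i) = \<Phi> (zs k)")
        case True
        have "\<forall>\<^sub>F p in sequentially. norm (\<Psi> p (zs i)) < c1 ^ p"
          using i k c True by (intro eventually_less_power[OF lim[OF zs_E]]) auto
        then show ?thesis by (rule eventually_mono) simp
      qed simp
    qed
    moreover have "\<forall>\<^sub>F p in sequentially. \<forall>j\<in>{1..r}. c2 ^ p < norm (\<Psi> p (zs (k + j)))"
    proof (rule eventually_ball_finite[OF finite_atLeastAtMost], rule ballI)
      fix j assume j: "j \<in> {1..r}"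
      then have "\<Phi> (zs (k + j)) = \<Phi> (zs (k + 1))" using level by blast
      then show "\<forall>\<^sub>F p in sequentially. c2 ^ p < norm (\<Psi> p (zs (k + j)))"
        using j k r c by (intro eventually_power_less[OF lim[OF zs_E]]) auto
    qed
    ultimately show ?thesis
    proof eventually_elim
      case (elim p)
      have "hat p < c1 ^ p" using elim(1) by (simp only: hat_less)
      moreover have "c2 ^ p < tilde p" using elim(2) by (simp only: less_tilde)
      moreover have "0 < c2 ^ p" using c by simp
      ultimately have "0 < tilde p" "hat p / tilde p \<le> c1 ^ p / c2 ^ p"
        using hat_nonneg[of p] by (linarith, intro frac_le) auto
      then show ?case by (simp add: \<delta>_eq c12 flip: power_divide)
    qed
  qed
  have \<delta>_nonneg: "\<forall>\<^sub>F p in sequentially. 0 \<le> \<delta> p"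
    using \<delta>_power[OF \<rho>(2)] by eventually_elim (simp add: \<delta>_eq hat_nonneg)
  have \<delta>_lim: "\<delta> \<longlonglongrightarrow> 0"
  proof -
    obtain \<rho>1 where \<rho>1: "\<rho> < \<rho>1" "\<rho>1 < 1" using dense[OF \<rho>(2)] by blast
    have "(\<lambda>p. \<rho>1 ^ p) \<longlonglongrightarrow> 0" using \<rho> \<rho>1 by (intro LIMSEQ_power_zero) auto
    then show ?thesis
      using \<delta>_power[OF \<rho>1(1)] by (intro tendsto_sandwich[OF \<delta>_nonneg _ tendsto_const]) (auto elim: eventually_mono)
  qed

  \<comment> \<open>Poles on the top level occur in the maximum; those on lower levels are
    eventually dominated by \<open>zs k\<close>.\<close>
  have hat_ev: "\<forall>\<^sub>F p in sequentially. \<forall>i\<in>{1..k}. norm (\<Psi> p (zs i)) \<le> hat p"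
  proof (rule eventually_ball_finite[OF finite_atLeastAtMost], rule ballI)
    fix i assume i: "i \<in> {1..k}"
    show "\<forall>\<^sub>F p in sequentially. norm (\<Psi> p (zs i)) \<le> hat p"
    proof (cases "\<Phi> (zs i) = \<Phi> (zs k)")
      case False
      then have "\<Phi> (zs i) < \<Phi> (zs k)" using ordered i k by (auto simp: less_le)
      then have "\<forall>\<^sub>F p in sequentially. norm (\<Psi> p (zs i)) < norm (\<Psi> p (zs k))"
        using i k by (intro growth) auto
      then show ?thesis
      proof eventually_elim
        case (elim p)
        then show ?case using hat[of k p] k by simp
      qed
    qed (use hat i in auto)
  qed
  \<comment> \<open>Poles beyond index \<open>k + r\<close> lie on strictly higher levels and
    eventually dominate \<open>zs (k + r)\<close>.\<close>
  have tilde_ev: "\<forall>\<^sub>F p in sequentially. \<forall>s\<in>{k<..\<mu>}. tilde p \<le> norm (\<Psi> p (zs s))"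
  proof (rule eventually_ball_finite[OF finite_greaterThanAtMost], rule ballI)
    fix s assume s: "s \<in> {k<..\<mu>}"
    show "\<forall>\<^sub>F p in sequentially. tilde p \<le> norm (\<Psi> p (zs s))"
    proof (cases "s \<le> k + r")
      case True
      then have "tilde p \<le> norm (\<Psi> p (zs s))" for p
        using tilde[of "s - k" p] s by simp linarith
      then show ?thesis by simp
    next
      case False
      then have "\<Phi> (zs (k + r)) < \<Phi> (zs (k + r + 1))" "\<Phi> (zs (k + r + 1)) \<le> \<Phi> (zs s)"
        using gap_above s ordered by auto
      then have "\<forall>\<^sub>F p in sequentially. norm (\<Psi> p (zs (k + r))) < norm (\<Psi> p (zs s))"
        using k r s by (intro growth) auto
      then show ?thesis
      proof eventually_elim
        case (elim p)
        then show ?case using tilde[of r p] r by simp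
      qed
    qed
  qed

  \<comment> \<open>Estimates for both determinants at large \<open>p\<close>\<close>
  obtain R where R: "0 \<le> R" "\<forall>\<^sub>F p in sequentially. \<forall>i\<in>{1..p + k}. norm (\<xi> p i) \<le> R"
    using exists_row_bound[OF no_limit_point_infinity] .
  have off: "\<forall>\<^sub>F p in sequentially. \<forall>s\<in>{1..\<mu>}. \<forall>i\<in>{1..p + k}. \<xi> p i \<noteq> zs s"
    using zs_E no_limit_points by (intro eventually_ball_finite ballI eventually_not_in_row) auto

  define V where "V = (\<Prod>j<k. \<Prod>i<j. zs (Suc j) - zs (Suc i))"
  define T0 where "T0 = T 1"
  define C where "C = det_bound k \<mu> (\<lambda>s. zs (Suc s))
      ((\<Sum>s=1..\<mu>. norm (ip q (v s))) * (1 + R + (\<Sum>s=1..\<mu>. norm (zs s))) ^ k)"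
  define A where "A = (\<lambda>p. \<Prod>i=1..k. \<Psi> p (zs i))"
  define w where "w = (\<lambda>z. \<Prod>i<k. zs (Suc i) - z)"
  define t where "t = (-1) ^ k * T0 * V"
  define D where "D = (\<lambda>p. Determinant.det (itea_system (u p) k))"
  \<comment> \<open>The closed form in \<open>T_det_eq\<close> mentions neither \<open>p\<close> nor
    the nodes.\<close>
  have T_const: "T p = T0" for p by (simp only: T0_def T T_det_eq)
  have V0: "V \<noteq> 0"
  proof -
    have "zs (Suc j) \<noteq> zs (Suc i)" if "i < j" "j < k" for i j
      using inj_onD[OF zs_distinct, of "Suc j" "Suc i"] that k by auto
    then show ?thesis by (auto simp: V_def)
  qed
  have T0: "T0 \<noteq> 0"
    using qv V0 by (simp add: T0_def T T_det_eq V_def[symmetric] prod.atLeast1_atMost_eq sign_def)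
  have t0: "t \<noteq> 0" using V0 T0 by (simp add: t_def)

  have est: "\<forall>\<^sub>F p in sequentially. A p \<noteq> 0 \<and> norm (A p * D p - t) \<le> C 1 * \<delta> p \<and>
      (\<forall>z W. (\<forall>s\<in>{1..\<mu>}. norm (zs s - z) \<le> W) \<longrightarrow>
        norm (A p * itea_Q (u p) (\<xi> p) k z - t * w z) \<le> C W * \<delta> p)"
    using R(2) off hat_ev tilde_ev \<delta>_power[OF \<rho>(2)] eventually_gt_at_top[of "d + k"]
  proof eventually_elim
    case (elim p)
    \<comment> \<open>At rate \<open>1\<close> the decay statement reads
      \<open>\<delta> p \<le> 1\<close>.\<close>
    have le: "hat p \<le> tilde p" using elim(5) by (auto simp: \<delta>_eq divide_le_eq)
    have row: "\<And>i. 1 \<le> i \<Longrightarrow> i \<le> p + k \<Longrightarrow> \<xi> p i \<notin> zs ` {1..\<mu>}"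
      "\<And>i. 1 \<le> i \<Longrightarrow> i \<le> p + k \<Longrightarrow> norm (\<xi> p i) \<le> R"
      using elim(1,2) by fastforce+
    have levels: "\<And>i. 1 \<le> i \<Longrightarrow> i \<le> k \<Longrightarrow> norm (psi (\<xi> p) 1 (p + k) (zs i)) \<le> hat p"
      "\<And>s. k < s \<Longrightarrow> s \<le> \<mu> \<Longrightarrow> tilde p \<le> norm (psi (\<xi> p) 1 (p + k) (zs s))"
      using elim(3,4) by (auto simp: Psi)
    have cons: "equal_points_consecutive (\<xi> p) (p + k)" using consecutive elim(6) by auto
    have k': "0 < k" "k \<le> \<mu>" using k by auto
    note est = itea_det_estimates[OF ip cons k' elim(6) row(1) F row(2) R(1) levels conjunct1[OF elim(5)] le,
        where q = q, folded C_def V_def]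
    have "A p \<noteq> 0"
      unfolding A_def Psi prod_zero_iff[OF finite_atLeastAtMost]
    proof
      assume "\<exists>i\<in>{1..k}. psi (\<xi> p) 1 (p + k) (zs i) = 0"
      then obtain i where i: "i \<in> {1..k}" "psi (\<xi> p) 1 (p + k) (zs i) = 0" by blast
      have "\<xi> p j \<noteq> zs i" if "1 \<le> j" "j \<le> p + k" for j
        using row(1)[OF that] i k by auto
      from psi_nonzero[of "p + k" "\<xi> p" "zs i" 1 "p + k", OF this] i show False by simp
    qed
    moreover have "norm (A p * D p - t) \<le> C 1 * \<delta> p"
      using est(1) by (simp only: A_def D_def t_def Psi u \<delta>_eq T_const[of p, symmetric] T)
    moreover have "norm (A p * itea_Q (u p) (\<xi> p) k z - t * w z) \<le> C W * \<delta> p"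
      if "\<forall>s\<in>{1..\<mu>}. norm (zs s - z) \<le> W" for z W
      using est(2)[where z = z and W = W] that by (simp only: A_def w_def t_def Psi u \<delta>_eq T_const[of p, symmetric] T)
    ultimately show ?case by blast
  qed

  have W: "\<exists>W\<ge>0. \<forall>z\<in>X. \<forall>s\<in>{1..\<mu>}. norm (zs s - z) \<le> W" if X: "compact X" for X
  proof -
    obtain b where b: "\<And>z. z \<in> X \<Longrightarrow> norm z \<le> b"
      using compact_imp_bounded[OF X] unfolding bounded_iff by blast
    have "norm (zs s - z) \<le> (\<Sum>s=1..\<mu>. norm (zs s)) + \<bar>b\<bar>" if "z \<in> X" "s \<in> {1..\<mu>}" for z s
      using norm_triangle_ineq4[of "zs s" z] b[OF that(1)] member_le_sum[OF that(2), of "\<lambda>s. norm (zs s)"]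
      by auto
    then show ?thesis by (intro exI[of _ "(\<Sum>s=1..\<mu>. norm (zs s)) + \<bar>b\<bar>"]) (auto intro!: add_nonneg_nonneg sum_nonneg)
  qed

  have C_nonneg: "0 \<le> C W" if "0 \<le> W" for W
    unfolding C_def det_bound_def using that R(1)
    by (intro sum_nonneg mult_nonneg_nonneg zero_le_power add_nonneg_nonneg) (auto intro!: sum_nonneg)

  have small: "\<forall>\<^sub>F p in sequentially. C 1 * \<delta> p \<le> norm t / 2"
  proof -
    have "(\<lambda>p. C 1 * \<delta> p) \<longlonglongrightarrow> C 1 * 0" using \<delta>_lim by (intro tendsto_intros)
    then have "\<forall>\<^sub>F p in sequentially. C 1 * \<delta> p < norm t / 2"
      using t0 by (intro order_tendstoD(2)) auto
    then show ?thesis by (rule eventually_mono) simp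
  qed

  \<comment> \<open>The denominator polynomial and the asymptotic claims\<close>
  have denom: "\<forall>\<^sub>F p in sequentially. D p \<noteq> 0 \<and> (\<forall>z W. 0 \<le> W \<longrightarrow> (\<forall>s\<in>{1..\<mu>}. norm (zs s - z) \<le> W) \<longrightarrow>
      norm (itea_denom (u p) (\<xi> p) k z - (\<Prod>i=1..k. z - zs i)) \<le> 2 * (C W + W ^ k * C 1) / norm t * \<delta> p)"
    using est small \<delta>_nonneg
  proof eventually_elim
    case (elim p)
    have est1: "norm (A p * D p - t) \<le> C 1 * \<delta> p" using elim by blast
    \<comment> \<open>Nonvanishing concerns \<open>D p\<close> alone, so the data on
      \<open>Q\<close> are filled with zeros.\<close>
    have D0: "D p \<noteq> 0"
      by (rule quotient_estimate(1)[OF est1, of 0 0 0 0]) (use elim t0 C_nonneg in auto)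
    moreover have "norm (itea_denom (u p) (\<xi> p) k z - (\<Prod>i=1..k. z - zs i)) \<le> 2 * (C W + W ^ k * C 1) / norm t * \<delta> p"
      if "0 \<le> W" and zW: "\<forall>s\<in>{1..\<mu>}. norm (zs s - z) \<le> W" for z W
    proof -
      have "norm (w z) = (\<Prod>i<k. norm (zs (Suc i) - z))" by (simp add: w_def prod_norm)
      also have "\<dots> \<le> (\<Prod>i<k. W)" using zW k by (intro prod_mono) auto
      finally have "norm (w z) \<le> W ^ k" by simp
      moreover have "norm (A p * itea_Q (u p) (\<xi> p) k z - t * w z) \<le> C W * \<delta> p"
        using elim zW by blast
      ultimately have "norm (itea_Q (u p) (\<xi> p) k z / D p - w z) \<le> 2 * (C W + W ^ k * C 1) / norm t * \<delta> p"
        using elim t0 C_nonneg[of 1] by (intro quotient_estimate(2)[OF est1]) auto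
      moreover have "itea_Q (u p) (\<xi> p) k z / D p = (-1) ^ k * itea_denom (u p) (\<xi> p) k z"
        using itea_Q_eq_itea_denom[of "u p" k "\<xi> p" z] D0 by (simp add: D_def)
      \<comment> \<open>This sign cancels the one relating \<open>Q\<close> to the denominator
        polynomial.\<close>
      moreover have "w z = (-1) ^ k * (\<Prod>i=1..k. z - zs i)"
        using prod.distrib[of "\<lambda>_. - 1 :: complex" "\<lambda>i. z - zs (Suc i)" "{..<k}"]
        by (simp add: w_def prod.atLeast1_atMost_eq)
      ultimately show ?thesis
        by (simp add: norm_mult norm_power flip: right_diff_distrib)
    qed
    ultimately show ?case by blast
  qed

  have part2: "\<exists>C. \<forall>\<^sub>F p in sequentially. \<forall>z\<in>X. \<exists>\<epsilon>.
          itea_Q (u p) (\<xi> p) k z =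
            (-1) ^ k * T p * vandermonde k (\<lambda>i. if i = 0 then z else zs i)
              * inverse (\<Prod>i=1..k. \<Psi> p (zs i)) * (1 + \<epsilon>)
          \<and> norm \<epsilon> \<le> C * \<delta> p" if X: "compact X" "X \<subseteq> - (zs ` {1..k})" for X
  proof -
    obtain W where W: "\<forall>z\<in>X. \<forall>s\<in>{1..\<mu>}. norm (zs s - z) \<le> W" using W[OF X(1)] by blast
    obtain \<eta> where \<eta>: "0 < \<eta>" "\<And>z s. z \<in> X \<Longrightarrow> s \<in> zs ` {1..k} \<Longrightarrow> \<eta> \<le> norm (s - z)"
      using compact_avoids_finite[OF X(1) _ X(2)] by auto
    \<comment> \<open>Each of the \<open>k\<close> factors is at least \<open>\<eta>\<close> on
      \<open>X\<close>; this is where \<open>X\<close> has to avoid the first \<open>k\<close>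
      poles.\<close>
    have w_low: "\<eta> ^ k \<le> norm (w z)" if "z \<in> X" for z
    proof -
      have "(\<Prod>i<k. \<eta>) \<le> (\<Prod>i<k. norm (zs (Suc i) - z))"
        using \<eta> that by (intro prod_mono) auto
      then show ?thesis by (simp add: w_def prod_norm)
    qed
    have "\<forall>\<^sub>F p in sequentially. \<forall>z\<in>X. \<exists>\<epsilon>.
          itea_Q (u p) (\<xi> p) k z =
            (-1) ^ k * T p * vandermonde k (\<lambda>i. if i = 0 then z else zs i)
              * inverse (\<Prod>i=1..k. \<Psi> p (zs i)) * (1 + \<epsilon>)
          \<and> norm \<epsilon> \<le> (C W / (norm t * \<eta> ^ k)) * \<delta> p"
      using est
    proof eventually_elim
      case (elim p)
      show ?case
      proof
        fix z assume z: "z \<in> X"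
        \<comment> \<open>The additive error divided by the main term, which is nonzero on
          \<open>X\<close>.\<close>
        define \<epsilon> where "\<epsilon> = (A p * itea_Q (u p) (\<xi> p) k z - t * w z) / (t * w z)"
        have tw: "0 < norm t * \<eta> ^ k" "norm t * \<eta> ^ k \<le> norm (t * w z)"
          using t0 \<eta>(1) w_low[OF z] by (auto simp: norm_mult intro: mult_left_mono)
        then have tw0: "t * w z \<noteq> 0" by auto
        have num: "norm (A p * itea_Q (u p) (\<xi> p) k z - t * w z) \<le> C W * \<delta> p"
          using elim W z by blast
        then have "norm \<epsilon> \<le> C W * \<delta> p / (norm t * \<eta> ^ k)"
          unfolding \<epsilon>_def norm_divide using tw by (intro frac_le order.trans[OF norm_ge_zero num]) auto
        moreover have "t * w z * (1 + \<epsilon>) = A p * itea_Q (u p) (\<xi> p) k z"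
          using tw0 by (simp add: \<epsilon>_def field_simps)
        then have "itea_Q (u p) (\<xi> p) k z = t * w z * inverse (A p) * (1 + \<epsilon>)"
          using elim by (simp add: field_simps)
        then have "itea_Q (u p) (\<xi> p) k z = (-1) ^ k * T p * vandermonde k (\<lambda>i. if i = 0 then z else zs i)
              * inverse (\<Prod>i=1..k. \<Psi> p (zs i)) * (1 + \<epsilon>)"
          by (simp only: vandermonde_insert t_def w_def V_def A_def T_const mult.assoc)
        ultimately show "\<exists>\<epsilon>. itea_Q (u p) (\<xi> p) k z =
            (-1) ^ k * T p * vandermonde k (\<lambda>i. if i = 0 then z else zs i)
              * inverse (\<Prod>i=1..k. \<Psi> p (zs i)) * (1 + \<epsilon>)
          \<and> norm \<epsilon> \<le> (C W / (norm t * \<eta> ^ k)) * \<delta> p"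
          by (intro exI[of _ \<epsilon>]) simp
      qed
    qed
    then show ?thesis by blast
  qed

  have part4: "\<exists>C\<ge>0. \<forall>\<^sub>F p in sequentially. \<forall>z\<in>X.
          norm (itea_denom (u p) (\<xi> p) k z - (\<Prod>i=1..k. z - zs i)) \<le> C * \<delta> p" if X: "compact X" for X
  proof -
    obtain W where W: "0 \<le> W" "\<forall>z\<in>X. \<forall>s\<in>{1..\<mu>}. norm (zs s - z) \<le> W" using W[OF X] by blast
    have "0 \<le> 2 * (C W + W ^ k * C 1) / norm t"
      using W C_nonneg by (intro divide_nonneg_nonneg mult_nonneg_nonneg add_nonneg_nonneg) auto
    moreover have "\<forall>\<^sub>F p in sequentially. \<forall>z\<in>X. norm (itea_denom (u p) (\<xi> p) k z - (\<Prod>i=1..k. z - zs i))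
        \<le> 2 * (C W + W ^ k * C 1) / norm t * \<delta> p"
      using denom by eventually_elim (use W in blast)
    ultimately show ?thesis by blast
  qed

  have part5: "limsup (\<lambda>p. ereal (norm (itea_denom (u p) (\<xi> p) k z - (\<Prod>i=1..k. z - zs i))
                              powr (1 / real p))) \<le> ereal \<rho>" for z
  proof -
    obtain C' where C': "0 \<le> C'" "\<forall>\<^sub>F p in sequentially. \<forall>z'\<in>{z}.
          norm (itea_denom (u p) (\<xi> p) k z' - (\<Prod>i=1..k. z' - zs i)) \<le> C' * \<delta> p"
      using part4[of "{z}"] by auto
    show ?thesis
    proof (rule limsup_powr_le[OF _ norm_ge_zero C'(1) _ \<rho>(1)])
      show "\<forall>\<^sub>F p in sequentially. \<delta> p \<le> \<rho>' ^ p" if "\<rho> < \<rho>'" for \<rho>'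
        using \<delta>_power[OF that] by (rule eventually_mono) simp
    qed (use C'(2) in simp)
  qed

  have part1: "\<forall>p\<ge>1. T p \<noteq> 0" using T_const T0 by simp
  have part3: "\<forall>\<^sub>F p in sequentially. Determinant.det (itea_system (u p) k) \<noteq> 0"
    using denom unfolding D_def by (rule eventually_mono) blast
  show ?thesis
  proof (intro conjI part1 part3 allI impI)
    show "limsup (\<lambda>p. ereal (norm (itea_denom (u p) (\<xi> p) k z - (\<Prod>i=1..k. z - zs i))
                              powr (1 / real p))) \<le> ereal (\<Phi> (zs k) / \<Phi> (zs (k + 1)))" for z
      using part5[of z] unfolding \<rho>_def .
    show "\<exists>C. \<forall>\<^sub>F p in sequentially. \<forall>z\<in>X.
        norm (itea_denom (u p) (\<xi> p) k z - (\<Prod>i=1..k. z - zs i)) \<le> C * \<delta> p" if "compact X" for X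
      using part4[OF that] by blast
  qed (rule part2; blast)
qed

end
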